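(* Let $S$ be a commutative additively idempotent semiring and let $n\geq 2$ be an integer. Then the following conditions are equivalent: (i) $\mathbf{M}_n(S)$ is congruence-simple. (ii) $S$ is congruence-simple, $|SS|\neq 1$ and $S$ has no bi-absorbing element. (iii) $S$ is isomorphic either to $L_2(\vee,\wedge)$ or to a subsemiring $A$ of the semiring $\mathbb{R}(\max,+)$ such that $A\cap\mathbb{R}^{+}\neq\emptyset$ and $A\cap\mathbb{R}^{-}\neq\emptyset$.
   Context: A semiring $S(+,\cdot)$ is a non-empty set with two associative binary operations such that $+$ is commutative and $\cdot$ distributes over $+$ from both sides (no zero or unity is required). It is commutative if $\cdot$ is commutative, and additively idempotent if $a+a=a$ for all $a\in S$. A congruence on $S$ is an equivalence relation preserved under addition and multiplication. $S$ is congruence-simple if it has exactly two congruences. $SS=\{ab : a,b\in S\}$. An element $w\in S$ is bi-absorbing if $aw=w=wa$ and $a+w=w$ for all $a\in S$. $\mathbf{M}_n(S)$ is the semiring of all $n\times n$ matrices over $S$ with the usual addition $(a_{ij})+(b_{ij})=(a_{ij}+b_{ij})$ and multiplication $(a_{ij})(b_{ij})=(\sum_k a_{ik}b_{kj})$. $L_2(\vee,\wedge)$ is the two-element lattice $\{0,1\}$, $0<1$, regarded as a semiring with addition $\vee$ and multiplication $\wedge$. $\mathbb{R}(\max,+)$ is the set of real numbers with semiring addition $\max$ and semiring multiplication the usual addition of reals. $\mathbb{R}^{+}$ and $\mathbb{R}^{-}$ are the sets of positive and negative reals. *)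

theory Defs
  imports Complex_Main "Jordan_Normal_Form.Matrix"
begin

text \<open>Semirings here need neither a zero nor a unity, so neither the \<open>semiring\<close> locale nor the
  \<open>ring\<close> record of HOL-Algebra applies.\<close>

record 'a srg = "'a partial_object" +
  sadd :: "'a \<Rightarrow> 'a \<Rightarrow> 'a" (infixl "\<boxplus>\<index>" 65)
  smul :: "'a \<Rightarrow> 'a \<Rightarrow> 'a" (infixl "\<boxdot>\<index>" 70)

locale srg =
  fixes S (structure)
  assumes nonempty: "carrier S \<noteq> {}"
    and sadd_closed: "\<lbrakk>a \<in> carrier S; b \<in> carrier S\<rbrakk> \<Longrightarrow> a \<boxplus> b \<in> carrier S"
    and smul_closed: "\<lbrakk>a \<in> carrier S; b \<in> carrier S\<rbrakk> \<Longrightarrow> a \<boxdot> b \<in> carrier S"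
    and sadd_assoc: "\<lbrakk>a \<in> carrier S; b \<in> carrier S; c \<in> carrier S\<rbrakk>
          \<Longrightarrow> (a \<boxplus> b) \<boxplus> c = a \<boxplus> (b \<boxplus> c)"
    and sadd_commute: "\<lbrakk>a \<in> carrier S; b \<in> carrier S\<rbrakk> \<Longrightarrow> a \<boxplus> b = b \<boxplus> a"
    and smul_assoc: "\<lbrakk>a \<in> carrier S; b \<in> carrier S; c \<in> carrier S\<rbrakk>
          \<Longrightarrow> (a \<boxdot> b) \<boxdot> c = a \<boxdot> (b \<boxdot> c)"
    and distrib_left: "\<lbrakk>a \<in> carrier S; b \<in> carrier S; c \<in> carrier S\<rbrakk>
          \<Longrightarrow> a \<boxdot> (b \<boxplus> c) = (a \<boxdot> b) \<boxplus> (a \<boxdot> c)"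
    and distrib_right: "\<lbrakk>a \<in> carrier S; b \<in> carrier S; c \<in> carrier S\<rbrakk>
          \<Longrightarrow> (a \<boxplus> b) \<boxdot> c = (a \<boxdot> c) \<boxplus> (b \<boxdot> c)"

locale comm_srg = srg +
  assumes smul_commute: "\<lbrakk>a \<in> carrier S; b \<in> carrier S\<rbrakk> \<Longrightarrow> a \<boxdot> b = b \<boxdot> a"

definition add_idempotent :: "('a, 'm) srg_scheme \<Rightarrow> bool" where
  "add_idempotent S \<longleftrightarrow> (\<forall>a \<in> carrier S. a \<boxplus>\<^bsub>S\<^esub> a = a)"

definition srg_congruence :: "('a, 'm) srg_scheme \<Rightarrow> ('a \<times> 'a) set \<Rightarrow> bool" where
  "srg_congruence S r \<longleftrightarrow> equiv (carrier S) r \<and>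
     (\<forall>a b c d. (a, b) \<in> r \<longrightarrow> (c, d) \<in> r \<longrightarrow>
        (a \<boxplus>\<^bsub>S\<^esub> c, b \<boxplus>\<^bsub>S\<^esub> d) \<in> r \<and> (a \<boxdot>\<^bsub>S\<^esub> c, b \<boxdot>\<^bsub>S\<^esub> d) \<in> r)"

definition congruence_simple :: "('a, 'm) srg_scheme \<Rightarrow> bool" where
  "congruence_simple S \<longleftrightarrow> card {r. srg_congruence S r} = 2"

definition product_set :: "('a, 'm) srg_scheme \<Rightarrow> 'a set" where
  "product_set S = {a \<boxdot>\<^bsub>S\<^esub> b | a b. a \<in> carrier S \<and> b \<in> carrier S}"

definition bi_absorbing :: "('a, 'm) srg_scheme \<Rightarrow> 'a \<Rightarrow> bool" where
  "bi_absorbing S w \<longleftrightarrow> w \<in> carrier S \<and>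
     (\<forall>a \<in> carrier S. a \<boxdot>\<^bsub>S\<^esub> w = w \<and> w \<boxdot>\<^bsub>S\<^esub> a = w \<and> a \<boxplus>\<^bsub>S\<^esub> w = w)"

text \<open>In the absence of a zero only non-empty sums exist:
  \<open>srg_sum S f m\<close> is \<open>f 0 + f 1 + \<dots> + f m\<close>, with \<open>m + 1\<close> summands.\<close>

primrec srg_sum :: "('a, 'm) srg_scheme \<Rightarrow> (nat \<Rightarrow> 'a) \<Rightarrow> nat \<Rightarrow> 'a" where
  "srg_sum S f 0 = f 0"
| "srg_sum S f (Suc m) = srg_sum S f m \<boxplus>\<^bsub>S\<^esub> f (Suc m)"

text \<open>Meaningful for \<open>n \<ge> 1\<close>. The operations \<open>+\<close> and \<open>*\<close> on type \<open>'a mat\<close> come from class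
  operations on \<open>'a\<close>, hence are not used.\<close>

definition mat_srg :: "nat \<Rightarrow> ('a, 'm) srg_scheme \<Rightarrow> 'a mat srg" where
  "mat_srg n S =
     \<lparr> carrier = {A \<in> carrier_mat n n. elements_mat A \<subseteq> carrier S},
       sadd = (\<lambda>A B. mat n n (\<lambda>(i, j). A $$ (i, j) \<boxplus>\<^bsub>S\<^esub> B $$ (i, j))),
       smul = (\<lambda>A B. mat n n (\<lambda>(i, j).
                 srg_sum S (\<lambda>k. A $$ (i, k) \<boxdot>\<^bsub>S\<^esub> B $$ (k, j)) (n - 1))) \<rparr>"

definition srg_isomorphic :: "('a, 'm) srg_scheme \<Rightarrow> ('b, 'k) srg_scheme \<Rightarrow> bool" where
  "srg_isomorphic S T \<longleftrightarrow> (\<exists>h. bij_betw h (carrier S) (carrier T) \<and>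
     (\<forall>a \<in> carrier S. \<forall>b \<in> carrier S.
        h (a \<boxplus>\<^bsub>S\<^esub> b) = h a \<boxplus>\<^bsub>T\<^esub> h b \<and> h (a \<boxdot>\<^bsub>S\<^esub> b) = h a \<boxdot>\<^bsub>T\<^esub> h b))"

definition subsemiring :: "'a set \<Rightarrow> ('a, 'm) srg_scheme \<Rightarrow> bool" where
  "subsemiring A S \<longleftrightarrow> A \<subseteq> carrier S \<and> A \<noteq> {} \<and>
     (\<forall>a \<in> A. \<forall>b \<in> A. a \<boxplus>\<^bsub>S\<^esub> b \<in> A \<and> a \<boxdot>\<^bsub>S\<^esub> b \<in> A)"

definition L2 :: "bool srg" where
  "L2 = \<lparr> carrier = UNIV, sadd = (\<or>), smul = (\<and>) \<rparr>"

definition R_max_plus :: "real srg" where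
  "R_max_plus = \<lparr> carrier = UNIV, sadd = max, smul = (+) \<rparr>"

end

theory Submission
  imports Defs "HOL-Algebra.Group"
begin

text \<open>A congruence-simple commutative idempotent \<open>S\<close> is either multiplicatively cancellative or has a
  multiplicatively absorbing element, since \<open>a x = a y\<close> defines a congruence in \<open>x\<close> and \<open>y\<close> for each
  \<open>a\<close>. Without bi-absorbing elements an absorbing element is a zero, and \<open>S\<close> is the two-element lattice
  because \<open>{0}\<close> and its complement are the classes of a congruence. In the cancellative case, for
  \<open>p < q\<close> the relation \<open>\<exists>k. x p\<^sup>k \<le> y q\<^sup>k \<and> y p\<^sup>k \<le> x q\<^sup>k\<close> is a congruence identifying
  \<open>p\<close> with \<open>q\<close>. Hence the order is archimedean, which forces it to be total, and Hoelder's theorem embeds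
  \<open>S\<close> into the reals. Conversely, in both cases of the classification suitable matrices
  \<open>P\<close>, \<open>Q\<close> make \<open>P X Q\<close> a constant matrix recording a single entry of \<open>X\<close>, so a nontrivial congruence
  on matrices identifies two, hence all, constant matrices; every matrix lies between two of these.\<close>

section \<open>Hoelder's theorem for cancellative ordered monoids\<close>

text \<open>Without inverses, the archimedean law cannot say that a power of \<open>q / p\<close>
  exceeds \<open>x / y\<close>; it reads \<open>x p^k \<preceq> y q^k\<close> instead.
  \<open>S\<close> may lack a unit, so one is adjoined formally, and the enlarged monoid is compared
  through multiples by a fixed \<open>u\<close> inside \<open>S\<close>. This yields only a
  preorder, hence no antisymmetry among the hypotheses.

  On the matrix side, \<open>S\<close> may have no zero from which to build matrix units. A column
  or row of \<open>u\<close> among entries \<open>v\<close> replaces them: products with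
  \<open>v\<close> lie below products with \<open>u\<close>, and an idempotent sum equals its
  greatest term if it has one. Idempotency also makes the constant matrices a copy of
  \<open>S\<close>. In the max-plus case, elements of both signs supply a large \<open>u\<close> and
  a small \<open>v\<close>; if one sign is missing, a set of small or of large elements collapses to
  a point. The bound \<open>n \<ge> 2\<close> lets two matrices agree in one entry and differ in
  another, which is what breaks simplicity in the excluded cases.\<close>

locale archimedean_comm_monoid = comm_monoid G for G (structure) +
  fixes le :: "'a \<Rightarrow> 'a \<Rightarrow> bool" (infix "\<preceq>" 50)
  assumes le_total: "\<lbrakk>x \<in> carrier G; y \<in> carrier G\<rbrakk> \<Longrightarrow> x \<preceq> y \<or> y \<preceq> x"
    and le_trans: "\<lbrakk>x \<preceq> y; y \<preceq> z; x \<in> carrier G; y \<in> carrier G; z \<in> carrier G\<rbrakk> \<Longrightarrow> x \<preceq> z"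
    and le_mult_cancel: "\<lbrakk>x \<in> carrier G; y \<in> carrier G; z \<in> carrier G\<rbrakk>
          \<Longrightarrow> x \<otimes> z \<preceq> y \<otimes> z \<longleftrightarrow> x \<preceq> y"
    and archimedean: "\<lbrakk>\<not> q \<preceq> p; p \<in> carrier G; q \<in> carrier G; x \<in> carrier G; y \<in> carrier G\<rbrakk>
          \<Longrightarrow> \<exists>k::nat. x \<otimes> p [^] k \<preceq> y \<otimes> q [^] k"
begin

lemma le_refl: "x \<in> carrier G \<Longrightarrow> x \<preceq> x"
  using le_total by blast

lemma mult_mono:
  assumes "a \<preceq> b" "c \<preceq> d" "a \<in> carrier G" "b \<in> carrier G" "c \<in> carrier G" "d \<in> carrier G"
  shows "a \<otimes> c \<preceq> b \<otimes> d"
proof (rule le_trans)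
  show "a \<otimes> c \<preceq> b \<otimes> c"
    using assms by (simp add: le_mult_cancel)
  show "b \<otimes> c \<preceq> b \<otimes> d"
    using assms by (simp add: le_mult_cancel m_comm[of b])
qed (use assms in auto)

lemma pow_mono:
  "\<lbrakk>x \<preceq> y; x \<in> carrier G; y \<in> carrier G\<rbrakk> \<Longrightarrow> x [^] k \<preceq> y [^] (k::nat)"
  by (induction k) (auto simp: le_refl intro: mult_mono)

text \<open>For \<open>k = m + 1\<close> the chain
  \<open>x^m y \<preceq> y^(m+1) \<preceq> x^(m+1)\<close> would give \<open>y \<preceq> x\<close>
  after cancelling \<open>x^m\<close>.\<close>

lemma pow_le_imp_zero:
  assumes "y [^] k \<preceq> x [^] (k::nat)" "\<not> y \<preceq> x" "x \<in> carrier G" "y \<in> carrier G"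
  shows "k = 0"
proof (cases k)
  case (Suc m)
  have "x [^] m \<otimes> y \<preceq> y [^] m \<otimes> y"
    using assms le_total by (intro mult_mono pow_mono) (auto simp: le_refl)
  then have "x [^] m \<otimes> y \<preceq> x [^] m \<otimes> x"
    by (rule le_trans) (use assms Suc in auto)
  with assms show ?thesis
    by (simp add: le_mult_cancel m_comm[of "x [^] m"])
qed simp

section \<open>Logarithms to the base q / p by rational cuts\<close>

context
  fixes p q
  assumes p: "p \<in> carrier G" and q: "q \<in> carrier G" and less: "\<not> q \<preceq> p"
begin

text \<open>Rational lower and upper bounds for the logarithm of \<open>x\<close> to the base \<open>q / p\<close>,
  cleared of denominators.\<close>

definition below :: "'a \<Rightarrow> real \<Rightarrow> bool" where
  "below x r \<longleftrightarrow> (\<exists>(i::nat) (j::nat) (k::nat). k > 0 \<and> r = (real i - real j) / real k \<and>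
     q [^] i \<otimes> p [^] j \<preceq> x [^] k \<otimes> (p [^] i \<otimes> q [^] j))"

definition above :: "'a \<Rightarrow> real \<Rightarrow> bool" where
  "above x r \<longleftrightarrow> (\<exists>(i::nat) (j::nat) (k::nat). k > 0 \<and> r = (real i - real j) / real k \<and>
     x [^] k \<otimes> (p [^] i \<otimes> q [^] j) \<preceq> q [^] i \<otimes> p [^] j)"

text \<open>Raising the first inequality to the power \<open>k'\<close> and the second to
  \<open>k\<close>, then multiplying, puts \<open>x^(k k')\<close> on both sides. Once it is
  cancelled, only powers of \<open>p\<close> and \<open>q\<close> remain, and
  \<open>\<not> q \<preceq> p\<close> decides how their exponents compare. That comparison is
  \<open>r \<le> s\<close> cleared of denominators.\<close>

lemma below_le_above:
  assumes "below x r" "above x s" and x: "x \<in> carrier G"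
  shows "r \<le> s"
proof -
  obtain i j k :: nat where b: "k > 0" "r = (real i - real j) / real k"
    "q [^] i \<otimes> p [^] j \<preceq> x [^] k \<otimes> (p [^] i \<otimes> q [^] j)"
    using assms(1) unfolding below_def by blast
  obtain i' j' k' :: nat where a: "k' > 0" "s = (real i' - real j') / real k'"
    "x [^] k' \<otimes> (p [^] i' \<otimes> q [^] j') \<preceq> q [^] i' \<otimes> p [^] j'"
    using assms(2) unfolding above_def by blast
  have "(q [^] i \<otimes> p [^] j) [^] k' \<otimes> (x [^] k' \<otimes> (p [^] i' \<otimes> q [^] j')) [^] k
      \<preceq> (x [^] k \<otimes> (p [^] i \<otimes> q [^] j)) [^] k' \<otimes> (q [^] i' \<otimes> p [^] j') [^] k"
    by (rule mult_mono[OF pow_mono pow_mono]) (use a b p q x in auto)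
  then have "x [^] (k * k') \<otimes> (q [^] (i * k') \<otimes> (p [^] (j * k') \<otimes> (p [^] (i' * k) \<otimes> q [^] (j' * k))))
      \<preceq> x [^] (k * k') \<otimes> (p [^] (i * k') \<otimes> (q [^] (j * k') \<otimes> (q [^] (i' * k) \<otimes> p [^] (j' * k))))"
    using p q x by (simp add: nat_pow_pow nat_pow_distrib m_ac mult.commute)
  then have "q [^] (i * k') \<otimes> (p [^] (j * k') \<otimes> (p [^] (i' * k) \<otimes> q [^] (j' * k)))
      \<preceq> p [^] (i * k') \<otimes> (q [^] (j * k') \<otimes> (q [^] (i' * k) \<otimes> p [^] (j' * k)))"
    using p q x by (simp add: le_mult_cancel m_comm[of "x [^] (k * k')"])
  then have *: "q [^] (i * k' + j' * k) \<otimes> p [^] (j * k' + i' * k)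
      \<preceq> q [^] (j * k' + i' * k) \<otimes> p [^] (i * k' + j' * k)"
    using p q by (simp add: nat_pow_mult[symmetric] m_ac)
  have "i * k' + j' * k \<le> j * k' + i' * k"
  proof (rule ccontr)
    assume "\<not> ?thesis"
    then obtain d where d: "i * k' + j' * k = (j * k' + i' * k) + d" "d > 0"
      by (metis less_imp_add_positive not_le)
    have "q [^] d \<otimes> (q [^] (j * k' + i' * k) \<otimes> p [^] (j * k' + i' * k))
      \<preceq> p [^] d \<otimes> (q [^] (j * k' + i' * k) \<otimes> p [^] (j * k' + i' * k))"
      using * p q unfolding d(1) by (simp add: nat_pow_mult[symmetric, of _ "_ + _" d] m_ac)
    then have "q [^] d \<preceq> p [^] d"
      using p q by (simp add: le_mult_cancel)
    then show False
      using pow_le_imp_zero d(2) less p q by blast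
  qed
  then have "real (i * k' + j' * k) \<le> real (j * k' + i' * k)"
    by (rule of_nat_mono)
  then show ?thesis
    using a(1) b(1) unfolding a(2) b(2) by (simp add: field_simps)
qed

lemma below_or_above:
  assumes "r \<in> \<rat>" "x \<in> carrier G"
  shows "below x r \<or> above x r"
proof -
  obtain m k where mk: "r = real_of_int m / real k" "k > 0"
    using assms(1) unfolding Rats_eq_int_div_nat by blast
  \<comment> \<open>Exponents are natural numbers, so the numerator is split into its positive and
    negative part.\<close>
  moreover have "real_of_int m = real (nat m) - real (nat (- m))"
    by simp
  moreover have "q [^] nat m \<otimes> p [^] nat (- m) \<preceq> x [^] k \<otimes> (p [^] nat m \<otimes> q [^] nat (- m))
      \<or> x [^] k \<otimes> (p [^] nat m \<otimes> q [^] nat (- m)) \<preceq> q [^] nat m \<otimes> p [^] nat (- m)"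
    using assms p q by (intro le_total) auto
  ultimately show ?thesis
    unfolding below_def above_def by metis
qed

text \<open>Both bounds are brought to the common denominator \<open>k k'\<close>; commutativity
  then collects the powers of \<open>x\<close> and \<open>y\<close> into one power of
  \<open>x \<otimes> y\<close>.\<close>

lemma below_mult:
  assumes "below x r" "below y s" and x: "x \<in> carrier G" and y: "y \<in> carrier G"
  shows "below (x \<otimes> y) (r + s)"
proof -
  obtain i j k :: nat where b: "k > 0" "r = (real i - real j) / real k"
    "q [^] i \<otimes> p [^] j \<preceq> x [^] k \<otimes> (p [^] i \<otimes> q [^] j)"
    using assms(1) unfolding below_def by blast
  obtain i' j' k' :: nat where a: "k' > 0" "s = (real i' - real j') / real k'"
    "q [^] i' \<otimes> p [^] j' \<preceq> y [^] k' \<otimes> (p [^] i' \<otimes> q [^] j')"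
    using assms(2) unfolding below_def by blast
  have "(q [^] i \<otimes> p [^] j) [^] k' \<otimes> (q [^] i' \<otimes> p [^] j') [^] k
      \<preceq> (x [^] k \<otimes> (p [^] i \<otimes> q [^] j)) [^] k' \<otimes> (y [^] k' \<otimes> (p [^] i' \<otimes> q [^] j')) [^] k"
    by (rule mult_mono[OF pow_mono pow_mono]) (use a b p q x y in auto)
  then have "q [^] (i * k' + i' * k) \<otimes> p [^] (j * k' + j' * k)
      \<preceq> (x \<otimes> y) [^] (k * k') \<otimes> (p [^] (i * k' + i' * k) \<otimes> q [^] (j * k' + j' * k))"
    using p q x y
    by (simp add: nat_pow_pow nat_pow_distrib nat_pow_mult[symmetric] m_ac mult.commute[of k'])
  moreover have "r + s = (real (i * k' + i' * k) - real (j * k' + j' * k)) / real (k * k')"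
    using a(1) b(1) unfolding a(2) b(2) by (simp add: field_simps)
  ultimately show ?thesis
    unfolding below_def using a(1) b(1) by (metis nat_0_less_mult_iff)
qed

lemma above_mult:
  assumes "above x r" "above y s" and x: "x \<in> carrier G" and y: "y \<in> carrier G"
  shows "above (x \<otimes> y) (r + s)"
proof -
  obtain i j k :: nat where b: "k > 0" "r = (real i - real j) / real k"
    "x [^] k \<otimes> (p [^] i \<otimes> q [^] j) \<preceq> q [^] i \<otimes> p [^] j"
    using assms(1) unfolding above_def by blast
  obtain i' j' k' :: nat where a: "k' > 0" "s = (real i' - real j') / real k'"
    "y [^] k' \<otimes> (p [^] i' \<otimes> q [^] j') \<preceq> q [^] i' \<otimes> p [^] j'"
    using assms(2) unfolding above_def by blast
  have "(x [^] k \<otimes> (p [^] i \<otimes> q [^] j)) [^] k' \<otimes> (y [^] k' \<otimes> (p [^] i' \<otimes> q [^] j')) [^] k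
      \<preceq> (q [^] i \<otimes> p [^] j) [^] k' \<otimes> (q [^] i' \<otimes> p [^] j') [^] k"
    by (rule mult_mono[OF pow_mono pow_mono]) (use a b p q x y in auto)
  then have "(x \<otimes> y) [^] (k * k') \<otimes> (p [^] (i * k' + i' * k) \<otimes> q [^] (j * k' + j' * k))
      \<preceq> q [^] (i * k' + i' * k) \<otimes> p [^] (j * k' + j' * k)"
    using p q x y
    by (simp add: nat_pow_pow nat_pow_distrib nat_pow_mult[symmetric] m_ac mult.commute[of k'])
  moreover have "r + s = (real (i * k' + i' * k) - real (j * k' + j' * k)) / real (k * k')"
    using a(1) b(1) unfolding a(2) b(2) by (simp add: field_simps)
  ultimately show ?thesis
    unfolding above_def using a(1) b(1) by (metis nat_0_less_mult_iff)
qed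

text \<open>Comparing \<open>x\<close> with the unit, the archimedean law gives
  \<open>p^k \<preceq> x q^k\<close>, which is a lower bound with \<open>i = 0\<close>,
  \<open>j = k\<close> and denominator 1.\<close>

lemma ex_below:
  assumes x: "x \<in> carrier G"
  shows "\<exists>r. below x r"
proof -
  obtain k :: nat where "\<one> \<otimes> p [^] k \<preceq> x \<otimes> q [^] k"
    using archimedean[OF less p q, of \<one> x] x by auto
  then have "below x (- real k)"
    unfolding below_def using p q x by (intro exI[of _ 0] exI[of _ k] exI[of _ 1]) auto
  then show ?thesis ..
qed

lemma ex_above:
  assumes x: "x \<in> carrier G"
  shows "\<exists>r. above x r"
proof -
  obtain k :: nat where "x \<otimes> p [^] k \<preceq> \<one> \<otimes> q [^] k"
    using archimedean[OF less p q, of x \<one>] x by auto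
  then have "above x (real k)"
    unfolding above_def using p q x by (intro exI[of _ k] exI[of _ 0] exI[of _ 1]) auto
  then show ?thesis ..
qed

text \<open>Multiplying by \<open>q^k\<close> turns a bound for \<open>p\<close> into one for
  \<open>q\<close> and raises the numerator by \<open>k\<close>. So the logarithms of
  \<open>p\<close> and \<open>q\<close> differ by at least 1, the gap on which
  \<open>log_base_strict_mono\<close> rests.\<close>

lemma below_base:
  assumes "below p r"
  shows "below q (r + 1)"
proof -
  obtain i j k :: nat where b: "k > 0" "r = (real i - real j) / real k"
    "q [^] i \<otimes> p [^] j \<preceq> p [^] k \<otimes> (p [^] i \<otimes> q [^] j)"
    using assms(1) unfolding below_def by blast
  have "(q [^] i \<otimes> p [^] j) \<otimes> q [^] k \<preceq> (p [^] k \<otimes> (p [^] i \<otimes> q [^] j)) \<otimes> q [^] k"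
    using b p q by (simp add: le_mult_cancel)
  then have "q [^] (i + k) \<otimes> p [^] j \<preceq> q [^] k \<otimes> (p [^] (i + k) \<otimes> q [^] j)"
    using p q by (simp add: nat_pow_mult[symmetric] m_ac)
  moreover have "r + 1 = (real (i + k) - real j) / real k"
    using b by (simp add: field_simps)
  ultimately show ?thesis
    unfolding below_def using b(1) by blast
qed

definition log_base :: "'a \<Rightarrow> real" where
  "log_base x = Sup {r. below x r}"

lemma le_log_base: "\<lbrakk>below x r; x \<in> carrier G\<rbrakk> \<Longrightarrow> r \<le> log_base x"
  unfolding log_base_def
  by (intro cSup_upper bdd_aboveI[where M = "SOME s. above x s"]) (auto intro: below_le_above someI_ex[OF ex_above])

lemma log_base_le: "\<lbrakk>\<And>r. below x r \<Longrightarrow> r \<le> s; x \<in> carrier G\<rbrakk> \<Longrightarrow> log_base x \<le> s"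
  unfolding log_base_def using ex_below by (intro cSup_least) auto

text \<open>A rational that is not a lower bound is an upper bound, hence at least the supremum.
  Rationality is essential: \<open>below x r\<close> makes \<open>r\<close> a quotient of
  integers.\<close>

lemma below_of_less_log: "\<lbrakk>r \<in> \<rat>; r < log_base x; x \<in> carrier G\<rbrakk> \<Longrightarrow> below x r"
  using below_or_above below_le_above log_base_le by (meson not_le)

lemma above_of_log_less: "\<lbrakk>r \<in> \<rat>; log_base x < r; x \<in> carrier G\<rbrakk> \<Longrightarrow> above x r"
  using below_or_above le_log_base by (meson not_le)

lemma log_base_le_above: "\<lbrakk>above x r; x \<in> carrier G\<rbrakk> \<Longrightarrow> log_base x \<le> r"
  using below_le_above log_base_le by blast

text \<open>Each inequality uses rational approximations from one side, with error
  \<open>e / 2\<close> per factor: upper bounds multiply for one direction, lower bounds for the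
  other.\<close>

lemma log_base_mult:
  assumes x: "x \<in> carrier G" and y: "y \<in> carrier G"
  shows "log_base (x \<otimes> y) = log_base x + log_base y"
proof (rule antisym)
  show "log_base (x \<otimes> y) \<le> log_base x + log_base y"
  proof (rule field_le_epsilon)
    fix e :: real
    assume "e > 0"
    obtain r s where "r \<in> \<rat>" "log_base x < r" "r < log_base x + e / 2"
      "s \<in> \<rat>" "log_base y < s" "s < log_base y + e / 2"
      using Rats_dense_in_real[of "log_base x" "log_base x + e / 2"]
        Rats_dense_in_real[of "log_base y" "log_base y + e / 2"] \<open>e > 0\<close> by auto
    moreover from this have "log_base (x \<otimes> y) \<le> r + s"
      using above_of_log_less above_mult log_base_le_above x y by auto
    ultimately show "log_base (x \<otimes> y) \<le> log_base x + log_base y + e"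
      by linarith
  qed
  show "log_base x + log_base y \<le> log_base (x \<otimes> y)"
  proof (rule field_le_epsilon)
    fix e :: real
    assume "e > 0"
    obtain r s where "r \<in> \<rat>" "log_base x - e / 2 < r" "r < log_base x"
      "s \<in> \<rat>" "log_base y - e / 2 < s" "s < log_base y"
      using Rats_dense_in_real[of "log_base x - e / 2" "log_base x"]
        Rats_dense_in_real[of "log_base y - e / 2" "log_base y"] \<open>e > 0\<close> by auto
    moreover from this have "r + s \<le> log_base (x \<otimes> y)"
      using below_of_less_log below_mult le_log_base x y by auto
    ultimately show "log_base x + log_base y \<le> log_base (x \<otimes> y) + e"
      by linarith
  qed
qed

lemma log_base_mono:
  assumes xy: "x \<preceq> y" and x: "x \<in> carrier G" and y: "y \<in> carrier G"
  shows "log_base x \<le> log_base y"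
proof (rule log_base_le)
  fix r
  assume "below x r"
  then obtain i j k :: nat where b: "k > 0" "r = (real i - real j) / real k"
    "q [^] i \<otimes> p [^] j \<preceq> x [^] k \<otimes> (p [^] i \<otimes> q [^] j)"
    unfolding below_def by blast
  have "x [^] k \<otimes> (p [^] i \<otimes> q [^] j) \<preceq> y [^] k \<otimes> (p [^] i \<otimes> q [^] j)"
    using x y p q pow_mono[OF xy x y] by (simp add: le_mult_cancel)
  with b(3) have "q [^] i \<otimes> p [^] j \<preceq> y [^] k \<otimes> (p [^] i \<otimes> q [^] j)"
    by (rule le_trans) (use x y p q in auto)
  then have "below y r"
    unfolding below_def using b by blast
  then show "r \<le> log_base y"
    using le_log_base y by blast
qed (fact x)

lemma log_base_pow: "x \<in> carrier G \<Longrightarrow> log_base (x [^] (k::nat)) = real k * log_base x"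
proof (induction k)
  case 0
  show ?case
    using log_base_mult[of \<one> \<one>] by simp
qed (simp add: log_base_mult algebra_simps)

text \<open>The archimedean law is applied with \<open>x\<close>, \<open>y\<close> as the strict
  pair and \<open>q\<close>, \<open>p\<close> as outer factors:
  \<open>q x^k \<preceq> p y^k\<close>. After taking logarithms, the gap of at least 1 between
  \<open>q\<close> and \<open>p\<close> must be made up by the \<open>k\<close>-fold difference
  between \<open>y\<close> and \<open>x\<close>, which is therefore positive.\<close>

lemma log_base_strict_mono:
  assumes xy: "\<not> y \<preceq> x" and x: "x \<in> carrier G" and y: "y \<in> carrier G"
  shows "log_base x < log_base y"
proof -
  have "log_base p \<le> log_base q - 1"
  proof (rule log_base_le)
    fix r
    assume "below p r"
    from le_log_base[OF below_base[OF this] q] show "r \<le> log_base q - 1"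
      by simp
  qed (fact p)
  moreover obtain k :: nat where "q \<otimes> x [^] k \<preceq> p \<otimes> y [^] k"
    using archimedean[OF xy x y q p] by blast
  then have "log_base (q \<otimes> x [^] k) \<le> log_base (p \<otimes> y [^] k)"
    using p q x y by (intro log_base_mono) auto
  ultimately have "real k * log_base x < real k * log_base y"
    using p q x y by (simp add: log_base_mult log_base_pow)
  then show ?thesis
    by (meson mult_left_mono not_le of_nat_0_le_iff)
qed

end

theorem ex_real_embedding:
  "\<exists>\<phi> :: 'a \<Rightarrow> real. \<forall>x \<in> carrier G. \<forall>y \<in> carrier G.
     \<phi> (x \<otimes> y) = \<phi> x + \<phi> y \<and> (x \<preceq> y \<longleftrightarrow> \<phi> x \<le> \<phi> y)"
proof (cases "\<exists>p \<in> carrier G. \<exists>q \<in> carrier G. \<not> q \<preceq> p")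
  case True
  then obtain p q where pq: "p \<in> carrier G" "q \<in> carrier G" "\<not> q \<preceq> p"
    by blast
  show ?thesis
    using log_base_mult[OF pq] log_base_mono[OF pq] log_base_strict_mono[OF pq]
    by (intro exI[of _ "log_base p q"]) (meson not_le)
next
  case False
  \<comment> \<open>Here any two elements are equivalent in the preorder, so the zero map is
    additive and reflects it.\<close>
  then show ?thesis
    by (intro exI[of _ "\<lambda>_. 0"]) auto
qed

end

section \<open>Congruence-simple commutative semirings\<close>

lemma srg_congruence_Id_on:
  assumes "\<And>a b. \<lbrakk>a \<in> carrier S; b \<in> carrier S\<rbrakk> \<Longrightarrow> a \<boxplus>\<^bsub>S\<^esub> b \<in> carrier S \<and> a \<boxdot>\<^bsub>S\<^esub> b \<in> carrier S"
  shows "srg_congruence S (Id_on (carrier S))"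
  using assms unfolding srg_congruence_def
  by (auto intro!: equivI refl_onI symI transI)

lemma srg_congruence_full:
  assumes "\<And>a b. \<lbrakk>a \<in> carrier S; b \<in> carrier S\<rbrakk> \<Longrightarrow> a \<boxplus>\<^bsub>S\<^esub> b \<in> carrier S \<and> a \<boxdot>\<^bsub>S\<^esub> b \<in> carrier S"
  shows "srg_congruence S (carrier S \<times> carrier S)"
  using assms unfolding srg_congruence_def
  by (auto intro!: equivI refl_onI symI transI)

text \<open>Only closure is assumed, so that the criterion applies to matrices without verifying the
  semiring laws for them.\<close>

lemma congruence_simple_iff:
  assumes closed: "\<And>a b. \<lbrakk>a \<in> carrier S; b \<in> carrier S\<rbrakk>
    \<Longrightarrow> a \<boxplus>\<^bsub>S\<^esub> b \<in> carrier S \<and> a \<boxdot>\<^bsub>S\<^esub> b \<in> carrier S"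
  shows "congruence_simple S \<longleftrightarrow> (\<exists>a \<in> carrier S. \<exists>b \<in> carrier S. a \<noteq> b) \<and>
    (\<forall>r. srg_congruence S r \<longrightarrow> r = Id_on (carrier S) \<or> r = carrier S \<times> carrier S)"
    (is "_ \<longleftrightarrow> ?nontriv \<and> ?two")
proof -
  let ?C = "carrier S"
  let ?R = "{r. srg_congruence S r}"
  have mem: "Id_on ?C \<in> ?R" "?C \<times> ?C \<in> ?R"
    using srg_congruence_Id_on[OF closed] srg_congruence_full[OF closed] by auto
  have diff: "Id_on ?C = ?C \<times> ?C \<longleftrightarrow> \<not> ?nontriv"
    by (auto simp: Id_on_iff)
  have bounds: "Id_on ?C \<subseteq> r \<and> r \<subseteq> ?C \<times> ?C" if "r \<in> ?R" for r
    using that by (auto simp: srg_congruence_def equiv_def refl_on_def)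
  show ?thesis
  proof
    assume "congruence_simple S"
    then have card: "card ?R = 2"
      by (simp add: congruence_simple_def)
    have ne: "Id_on ?C \<noteq> ?C \<times> ?C"
    proof
      assume "Id_on ?C = ?C \<times> ?C"
      then have "r = ?C \<times> ?C" if "r \<in> ?R" for r
        using bounds[OF that] by (intro subset_antisym) simp_all
      with mem have "?R = {?C \<times> ?C}"
        by auto
      then show False
        using card by simp
    qed
    obtain r s where "?R = {r, s}"
      using card by (auto simp: card_2_iff)
    with mem ne have "?R = {Id_on ?C, ?C \<times> ?C}"
      by auto
    then show "?nontriv \<and> ?two"
      using ne diff by auto
  next
    assume *: "?nontriv \<and> ?two"
    then have "?R = {Id_on ?C, ?C \<times> ?C}"
      using mem by auto
    then show "congruence_simple S"
      unfolding congruence_simple_def using * diff by simp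
  qed
qed

lemma (in srg) simple_iff:
  "congruence_simple S \<longleftrightarrow> (\<exists>a \<in> carrier S. \<exists>b \<in> carrier S. a \<noteq> b) \<and>
    (\<forall>r. srg_congruence S r \<longrightarrow> r = Id_on (carrier S) \<or> r = carrier S \<times> carrier S)"
  by (rule congruence_simple_iff) (simp add: sadd_closed smul_closed)

context comm_srg
begin

lemma smul_lcomm:
  "\<lbrakk>a \<in> carrier S; b \<in> carrier S; c \<in> carrier S\<rbrakk> \<Longrightarrow> a \<boxdot> (b \<boxdot> c) = b \<boxdot> (a \<boxdot> c)"
  by (metis smul_assoc smul_commute)

lemmas smul_ac = smul_assoc smul_commute smul_lcomm

lemma sadd_lcomm:
  "\<lbrakk>a \<in> carrier S; b \<in> carrier S; c \<in> carrier S\<rbrakk> \<Longrightarrow> a \<boxplus> (b \<boxplus> c) = b \<boxplus> (a \<boxplus> c)"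
  by (metis sadd_assoc sadd_commute)

lemmas sadd_ac = sadd_assoc sadd_commute sadd_lcomm


text \<open>By commutativity and transitivity it suffices to change one operand at a time:
  \<open>a + c\<close>, \<open>b + c\<close>, \<open>b + d\<close> are successively related, and
  likewise for products. The dichotomy is then available for any relation given by a
  formula.\<close>

lemma simple_cases [consumes 1, case_names refl sym trans sadd smul]:
  assumes "congruence_simple S"
    and refl: "\<And>x. x \<in> carrier S \<Longrightarrow> P x x"
    and sym: "\<And>x y. \<lbrakk>P x y; x \<in> carrier S; y \<in> carrier S\<rbrakk> \<Longrightarrow> P y x"
    and trans: "\<And>x y z. \<lbrakk>P x y; P y z; x \<in> carrier S; y \<in> carrier S; z \<in> carrier S\<rbrakk> \<Longrightarrow> P x z"
    and sadd: "\<And>x y c. \<lbrakk>P x y; x \<in> carrier S; y \<in> carrier S; c \<in> carrier S\<rbrakk> \<Longrightarrow> P (x \<boxplus> c) (y \<boxplus> c)"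
    and smul: "\<And>x y c. \<lbrakk>P x y; x \<in> carrier S; y \<in> carrier S; c \<in> carrier S\<rbrakk> \<Longrightarrow> P (x \<boxdot> c) (y \<boxdot> c)"
  shows "(\<forall>x \<in> carrier S. \<forall>y \<in> carrier S. P x y \<longrightarrow> x = y)
    \<or> (\<forall>x \<in> carrier S. \<forall>y \<in> carrier S. P x y)"
proof -
  let ?r = "{(x, y) \<in> carrier S \<times> carrier S. P x y}"
  have "srg_congruence S ?r"
    unfolding srg_congruence_def
  proof (intro conjI allI impI)
    show "equiv (carrier S) ?r"
    proof (intro equivI refl_onI symI transI)
      fix x y z
      assume "(x, y) \<in> ?r" "(y, z) \<in> ?r"
      then show "(x, z) \<in> ?r"
        using trans[of x y z] by simp
    qed (auto intro: refl sym)
    fix a b c d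
    assume "(a, b) \<in> ?r" "(c, d) \<in> ?r"
    then have *: "P a b" "P c d" "a \<in> carrier S" "b \<in> carrier S" "c \<in> carrier S" "d \<in> carrier S"
      by auto
    then have "P (a \<boxplus> c) (b \<boxplus> c)" "P (c \<boxplus> b) (d \<boxplus> b)"
      using sadd by auto
    with * show "(a \<boxplus> c, b \<boxplus> d) \<in> ?r"
      using trans[of "a \<boxplus> c" "b \<boxplus> c" "b \<boxplus> d"] by (simp add: sadd_commute sadd_closed)
    from * have "P (a \<boxdot> c) (b \<boxdot> c)" "P (c \<boxdot> b) (d \<boxdot> b)"
      using smul by auto
    with * show "(a \<boxdot> c, b \<boxdot> d) \<in> ?r"
      using trans[of "a \<boxdot> c" "b \<boxdot> c" "b \<boxdot> d"] by (simp add: smul_commute smul_closed)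
  qed
  then have "?r = Id_on (carrier S) \<or> ?r = carrier S \<times> carrier S"
    using \<open>congruence_simple S\<close> simple_iff by simp
  then show ?thesis
  proof
    assume eq: "?r = Id_on (carrier S)"
    have "x = y" if "P x y" "x \<in> carrier S" "y \<in> carrier S" for x y
    proof -
      have "(x, y) \<in> Id_on (carrier S)"
        unfolding eq[symmetric] using that by simp
      then show ?thesis
        by (simp add: Id_on_iff)
    qed
    then show ?thesis
      by blast
  next
    assume eq: "?r = carrier S \<times> carrier S"
    have "P x y" if "x \<in> carrier S" "y \<in> carrier S" for x y
    proof -
      have "(x, y) \<in> ?r"
        unfolding eq using that by simp
      then show ?thesis
        by simp
    qed
    then show ?thesis
      by blast
  qed
qed

text \<open>If \<open>a\<close> does not cancel, the congruence it defines is full, so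
  \<open>a x\<close> takes the single value \<open>a a\<close>. Then
  \<open>(a a) x = a (a x) = a a\<close>, and the absorbing element is the square of
  \<open>a\<close>.\<close>

lemma simple_cancellative_or_absorbing:
  assumes simple: "congruence_simple S"
  obtains (cancel) "\<And>a x y. \<lbrakk>a \<boxdot> x = a \<boxdot> y; a \<in> carrier S; x \<in> carrier S; y \<in> carrier S\<rbrakk> \<Longrightarrow> x = y"
  | (absorb) z where "z \<in> carrier S" "\<And>x. x \<in> carrier S \<Longrightarrow> z \<boxdot> x = z"
proof (cases "\<exists>a \<in> carrier S. \<exists>x \<in> carrier S. \<exists>y \<in> carrier S. a \<boxdot> x = a \<boxdot> y \<and> x \<noteq> y")
  case True
  then obtain a b b' where a: "a \<in> carrier S"
    and b: "b \<in> carrier S" "b' \<in> carrier S" "a \<boxdot> b = a \<boxdot> b'" "b \<noteq> b'"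
    by blast
  have "(\<forall>x \<in> carrier S. \<forall>y \<in> carrier S. a \<boxdot> x = a \<boxdot> y \<longrightarrow> x = y)
    \<or> (\<forall>x \<in> carrier S. \<forall>y \<in> carrier S. a \<boxdot> x = a \<boxdot> y)"
    using simple
    by (rule simple_cases) (use a in \<open>auto simp: distrib_left smul_assoc[symmetric]\<close>)
  then have const: "a \<boxdot> x = a \<boxdot> a" if "x \<in> carrier S" for x
  proof
    assume "\<forall>x \<in> carrier S. \<forall>y \<in> carrier S. a \<boxdot> x = a \<boxdot> y \<longrightarrow> x = y"
    with b have "b = b'"
      by simp
    with b show ?thesis
      by simp
  next
    assume "\<forall>x \<in> carrier S. \<forall>y \<in> carrier S. a \<boxdot> x = a \<boxdot> y"
    from bspec[OF bspec[OF this that] a] show ?thesis .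
  qed
  have "(a \<boxdot> a) \<boxdot> x = a \<boxdot> a" if "x \<in> carrier S" for x
    using a that smul_assoc[of a a x] const[of "a \<boxdot> x"] by (simp add: smul_closed)
  then show ?thesis
    using absorb[of "a \<boxdot> a"] a by (simp add: smul_closed)
next
  case False
  then show ?thesis
    using cancel by blast
qed

lemma product_set_const:
  assumes "\<And>x y. \<lbrakk>x \<in> carrier S; y \<in> carrier S\<rbrakk> \<Longrightarrow> x \<boxdot> y = c"
  shows "card (product_set S) = 1"
proof -
  have "product_set S = {c}"
    using assms nonempty unfolding product_set_def by auto
  then show ?thesis
    by simp
qed

end

section \<open>The case of a multiplicatively absorbing element\<close>

locale idem_comm_srg = comm_srg +
  assumes idem: "a \<in> carrier S \<Longrightarrow> a \<boxplus> a = a"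
begin

lemma absorbing_imp_L2:
  assumes simple: "congruence_simple S" and prod: "card (product_set S) \<noteq> 1"
    and no_bi: "\<not> (\<exists>w. bi_absorbing S w)"
    and z: "z \<in> carrier S" and absorb: "\<And>x. x \<in> carrier S \<Longrightarrow> z \<boxdot> x = z"
  shows "srg_isomorphic S L2"
proof -
  let ?C = "carrier S"
  have absorb': "x \<boxdot> z = z" if "x \<in> ?C" for x
    using absorb[OF that] that z by (simp add: smul_commute)
  \<comment> \<open>If this congruence were full, \<open>x + z = z + z = z\<close> would make
    \<open>z\<close> bi-absorbing.\<close>
  have "(\<forall>x \<in> ?C. \<forall>y \<in> ?C. x \<boxplus> z = y \<boxplus> z \<longrightarrow> x = y) \<or> (\<forall>x \<in> ?C. \<forall>y \<in> ?C. x \<boxplus> z = y \<boxplus> z)"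
    using simple
  proof (rule simple_cases)
    fix x y c
    assume xyc: "x \<boxplus> z = y \<boxplus> z" "x \<in> ?C" "y \<in> ?C" "c \<in> ?C"
    then show "(x \<boxplus> c) \<boxplus> z = (y \<boxplus> c) \<boxplus> z"
      using z by (metis sadd_assoc sadd_commute)
    from xyc show "(x \<boxdot> c) \<boxplus> z = (y \<boxdot> c) \<boxplus> z"
      using z absorb distrib_right by metis
  qed auto
  moreover have "\<not> (\<forall>x \<in> ?C. \<forall>y \<in> ?C. x \<boxplus> z = y \<boxplus> z)"
  proof
    assume "\<forall>x \<in> ?C. \<forall>y \<in> ?C. x \<boxplus> z = y \<boxplus> z"
    then have "x \<boxplus> z = z" if "x \<in> ?C" for x
      using that z idem by metis
    then have "bi_absorbing S z"
      using z absorb absorb' unfolding bi_absorbing_def by auto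
    with no_bi show False
      by blast
  qed
  \<comment> \<open>Adding \<open>z\<close> is now injective, and by idempotency
    \<open>x + z\<close> and \<open>x\<close> have the same image.\<close>
  ultimately have zero: "x \<boxplus> z = x" if "x \<in> ?C" for x
    using that z idem sadd_assoc sadd_closed by metis
  \<comment> \<open>Elements acting alike by multiplication are identified. If all did, every
    product would equal \<open>a z = z\<close>, against the assumption on the product set.\<close>
  have "(\<forall>x \<in> ?C. \<forall>y \<in> ?C. (\<forall>a \<in> ?C. a \<boxdot> x = a \<boxdot> y) \<longrightarrow> x = y)
    \<or> (\<forall>x \<in> ?C. \<forall>y \<in> ?C. \<forall>a \<in> ?C. a \<boxdot> x = a \<boxdot> y)"
    using simple
    by (rule simple_cases) (auto simp: distrib_left smul_assoc[symmetric])
  moreover have "\<not> (\<forall>x \<in> ?C. \<forall>y \<in> ?C. \<forall>a \<in> ?C. a \<boxdot> x = a \<boxdot> y)"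
    using product_set_const[of z] prod absorb' z by metis
  ultimately have faithful: "x = y" if "\<forall>a \<in> ?C. a \<boxdot> x = a \<boxdot> y" "x \<in> ?C" "y \<in> ?C" for x y
    using that by blast
  \<comment> \<open>By \<open>faithful\<close>, an element \<open>a\<close> other than
    \<open>z\<close> does not send everything to \<open>z\<close>; its multiplication is therefore
    injective and sends only \<open>z\<close> to \<open>z\<close>.\<close>
  have no_zero_div: "x = z" if "x \<boxdot> a = z" "a \<noteq> z" "x \<in> ?C" "a \<in> ?C" for x a
  proof -
    have "(\<forall>x \<in> ?C. \<forall>y \<in> ?C. a \<boxdot> x = a \<boxdot> y \<longrightarrow> x = y) \<or> (\<forall>x \<in> ?C. \<forall>y \<in> ?C. a \<boxdot> x = a \<boxdot> y)"
      using simple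
      by (rule simple_cases) (use that in \<open>auto simp: distrib_left smul_assoc[symmetric]\<close>)
    moreover have "\<not> (\<forall>x \<in> ?C. \<forall>y \<in> ?C. a \<boxdot> x = a \<boxdot> y)"
      using faithful[of a z] that z absorb' smul_commute by metis
    ultimately show ?thesis
      using that z absorb' smul_commute by metis
  qed
  have sum_zero: "x \<boxplus> y = z \<longleftrightarrow> x = z \<and> y = z" if "x \<in> ?C" "y \<in> ?C" for x y
    using that z zero idem sadd_assoc sadd_commute by metis
  \<comment> \<open>Compatibility with sums is \<open>sum_zero\<close>, compatibility with products
    is \<open>no_zero_div\<close>. As \<open>z\<close> is separated from \<open>e\<close>, the
    relation is equality and the complement of \<open>z\<close> is a single point.\<close>
  have "(\<forall>x \<in> ?C. \<forall>y \<in> ?C. (x = z \<longleftrightarrow> y = z) \<longrightarrow> x = y) \<or> (\<forall>x \<in> ?C. \<forall>y \<in> ?C. x = z \<longleftrightarrow> y = z)"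
    using simple
    by (rule simple_cases) (use z sum_zero no_zero_div absorb absorb' in metis)+
  moreover obtain e where e: "e \<in> ?C" "e \<noteq> z"
    using simple z by (auto simp: simple_iff)
  ultimately have C: "x = z \<or> x = e" if "x \<in> ?C" for x
    using that z by blast
  then have carr: "?C = {z, e}"
    using e z by blast
  have "e \<boxdot> e = e"
    using no_zero_div[of e e] C[of "e \<boxdot> e"] e smul_closed by auto
  then show ?thesis
    unfolding srg_isomorphic_def carr
    by (intro exI[of _ "\<lambda>x. x \<noteq> z"])
      (use e z zero idem absorb absorb' sum_zero in \<open>auto simp: L2_def bij_betw_def inj_on_def image_def\<close>)
qed

section \<open>The natural order of an idempotent addition\<close>

abbreviation below_eq (infix "\<preceq>" 50) where
  "x \<preceq> y \<equiv> x \<boxplus> y = y"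

lemma ple_trans: "\<lbrakk>x \<preceq> y; y \<preceq> z; x \<in> carrier S; y \<in> carrier S; z \<in> carrier S\<rbrakk> \<Longrightarrow> x \<preceq> z"
  by (metis sadd_assoc)

lemma ple_antisym: "\<lbrakk>x \<preceq> y; y \<preceq> x; x \<in> carrier S; y \<in> carrier S\<rbrakk> \<Longrightarrow> x = y"
  by (metis sadd_commute)

lemma ple_sadd1: "\<lbrakk>x \<in> carrier S; y \<in> carrier S\<rbrakk> \<Longrightarrow> x \<preceq> x \<boxplus> y"
  by (metis sadd_assoc idem)

lemma ple_sadd2: "\<lbrakk>x \<in> carrier S; y \<in> carrier S\<rbrakk> \<Longrightarrow> y \<preceq> x \<boxplus> y"
  by (metis ple_sadd1 sadd_commute)

lemma sadd_mono:
  assumes "x \<preceq> x'" "y \<preceq> y'" "x \<in> carrier S" "y \<in> carrier S" "x' \<in> carrier S" "y' \<in> carrier S"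
  shows "x \<boxplus> y \<preceq> x' \<boxplus> y'"
proof -
  have "(x \<boxplus> y) \<boxplus> (x' \<boxplus> y') = (x \<boxplus> x') \<boxplus> (y \<boxplus> y')"
    using assms(3-) by (simp add: sadd_ac sadd_closed)
  then show ?thesis
    using assms by simp
qed

lemma smul_mono1:
  "\<lbrakk>x \<preceq> x'; x \<in> carrier S; x' \<in> carrier S; y \<in> carrier S\<rbrakk> \<Longrightarrow> x \<boxdot> y \<preceq> x' \<boxdot> y"
  by (metis distrib_right)

lemma smul_mono:
  assumes "x \<preceq> x'" "y \<preceq> y'" "x \<in> carrier S" "y \<in> carrier S" "x' \<in> carrier S" "y' \<in> carrier S"
  shows "x \<boxdot> y \<preceq> x' \<boxdot> y'"
proof (rule ple_trans)
  show "x \<boxdot> y \<preceq> x' \<boxdot> y"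
    using assms by (intro smul_mono1)
  show "x' \<boxdot> y \<preceq> x' \<boxdot> y'"
    using assms by (metis distrib_left)
qed (use assms smul_closed in auto)

end

text \<open>The new unit \<open>None\<close> gives meaning to the zeroth power and to bounds
  relative to 1. If \<open>S\<close> already has a unit \<open>e\<close>, then \<open>None\<close>
  and \<open>Some e\<close> stay distinct but have equal multiples by \<open>u\<close>, so the
  preorder below does not separate them.\<close>

definition adjoin_unit :: "('a, 'm) srg_scheme \<Rightarrow> 'a option monoid" where
  "adjoin_unit S = \<lparr>carrier = insert None (Some ` carrier S),
     mult = (\<lambda>x y. case x of None \<Rightarrow> y
       | Some a \<Rightarrow> (case y of None \<Rightarrow> x | Some b \<Rightarrow> Some (a \<boxdot>\<^bsub>S\<^esub> b))),
     one = None\<rparr>"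

lemma (in comm_srg) comm_monoid_adjoin_unit: "comm_monoid (adjoin_unit S)"
proof (rule comm_monoidI)
  fix x y
  assume "x \<in> carrier (adjoin_unit S)" "y \<in> carrier (adjoin_unit S)"
  then show "x \<otimes>\<^bsub>adjoin_unit S\<^esub> y = y \<otimes>\<^bsub>adjoin_unit S\<^esub> x"
    by (auto simp: adjoin_unit_def smul_commute)
qed (auto simp: adjoin_unit_def smul_closed smul_assoc)

section \<open>The archimedean property in the cancellative case\<close>

locale cancellative_simple_srg = idem_comm_srg +
  assumes simple: "congruence_simple S"
    and cancel: "\<lbrakk>a \<boxdot> x = a \<boxdot> y; a \<in> carrier S; x \<in> carrier S; y \<in> carrier S\<rbrakk> \<Longrightarrow> x = y"
begin

lemma ple_smul_cancel:
  "\<lbrakk>c \<in> carrier S; x \<in> carrier S; y \<in> carrier S\<rbrakk> \<Longrightarrow> c \<boxdot> x \<preceq> c \<boxdot> y \<longleftrightarrow> x \<preceq> y"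
  by (metis cancel distrib_left sadd_closed)

text \<open>The sequences stand for \<open>u p^k\<close> and \<open>u q^k\<close>, where
  \<open>p\<close> and \<open>q\<close> may be the adjoined unit; the law
  \<open>u f(k + m) = f k f m\<close> replaces the power law, so that everything stays inside
  \<open>S\<close>. The relation \<open>P\<close> identifies the distinct elements
  \<open>f 1\<close> and \<open>g 1\<close>, hence by simplicity all elements.\<close>

lemma simple_archimedean:
  fixes f g :: "nat \<Rightarrow> 'a"
  assumes u: "u \<in> carrier S"
    and f: "\<And>k. f k \<in> carrier S" "\<And>k m. u \<boxdot> f (k + m) = f k \<boxdot> f m"
    and g: "\<And>k. g k \<in> carrier S" "\<And>k m. u \<boxdot> g (k + m) = g k \<boxdot> g m"
    and fg: "\<And>k. f k \<preceq> g k" and ne: "f 1 \<noteq> g 1"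
    and x: "x \<in> carrier S" and y: "y \<in> carrier S"
  shows "\<exists>k. x \<boxdot> f k \<preceq> y \<boxdot> g k"
proof -
  let ?C = "carrier S"
  define P where "P x y \<longleftrightarrow> (\<exists>k. x \<boxdot> f k \<preceq> y \<boxdot> g k \<and> y \<boxdot> f k \<preceq> x \<boxdot> g k)" for x y
  \<comment> \<open>This gives transitivity: exponents add when the two inequalities are chained,
    and the surplus factor \<open>u\<close> cancels.\<close>
  have step: "x \<boxdot> f (k + m) \<preceq> z \<boxdot> g (k + m)"
    if *: "x \<boxdot> f k \<preceq> y \<boxdot> g k" "y \<boxdot> f m \<preceq> z \<boxdot> g m" "x \<in> ?C" "y \<in> ?C" "z \<in> ?C" for x y z k m
  proof -
    have "(x \<boxdot> f k) \<boxdot> f m \<preceq> (y \<boxdot> g k) \<boxdot> f m"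
      by (rule smul_mono1) (use * f g in \<open>auto simp: smul_closed\<close>)
    moreover have "(y \<boxdot> f m) \<boxdot> g k \<preceq> (z \<boxdot> g m) \<boxdot> g k"
      by (rule smul_mono1) (use * f g in \<open>auto simp: smul_closed\<close>)
    moreover have "(y \<boxdot> f m) \<boxdot> g k = (y \<boxdot> g k) \<boxdot> f m"
      using * f g by (simp add: smul_ac smul_closed)
    ultimately have "(x \<boxdot> f k) \<boxdot> f m \<preceq> (z \<boxdot> g m) \<boxdot> g k"
      using ple_trans[of "(x \<boxdot> f k) \<boxdot> f m" "(y \<boxdot> g k) \<boxdot> f m" "(z \<boxdot> g m) \<boxdot> g k"] * f(1) g(1)
      by (simp add: smul_closed)
    moreover have "(x \<boxdot> f k) \<boxdot> f m = u \<boxdot> (x \<boxdot> f (k + m))"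
      using * f(1) u by (simp add: smul_lcomm[of u] f(2) smul_closed smul_assoc)
    moreover have "(z \<boxdot> g m) \<boxdot> g k = u \<boxdot> (z \<boxdot> g (k + m))"
      using * g(1) u
      by (simp add: smul_lcomm[of u] g(2)[of m k, simplified add.commute[of m k]] smul_closed smul_assoc)
    ultimately show ?thesis
      using * u f(1) g(1) by (simp add: ple_smul_cancel smul_closed)
  qed
  have "(\<forall>x \<in> ?C. \<forall>y \<in> ?C. P x y \<longrightarrow> x = y) \<or> (\<forall>x \<in> ?C. \<forall>y \<in> ?C. P x y)"
    using simple
  proof (rule simple_cases)
    fix x
    assume "x \<in> ?C"
    then show "P x x"
      unfolding P_def using f g fg by (auto intro!: smul_mono idem)
  next
    fix x y
    assume "P x y"
    then show "P y x"
      unfolding P_def by blast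
  next
    fix x y z
    assume "P x y" "P y z" and xyz: "x \<in> ?C" "y \<in> ?C" "z \<in> ?C"
    then obtain k m where "x \<boxdot> f k \<preceq> y \<boxdot> g k" "y \<boxdot> f k \<preceq> x \<boxdot> g k"
      "y \<boxdot> f m \<preceq> z \<boxdot> g m" "z \<boxdot> f m \<preceq> y \<boxdot> g m"
      unfolding P_def by blast
    then have "x \<boxdot> f (k + m) \<preceq> z \<boxdot> g (k + m)" "z \<boxdot> f (m + k) \<preceq> x \<boxdot> g (m + k)"
      using step xyz by blast+
    then show "P x z"
      unfolding P_def by (metis add.commute)
  next
    fix x y c
    assume "P x y" and xyc: "x \<in> ?C" "y \<in> ?C" "c \<in> ?C"
    then obtain k where k: "x \<boxdot> f k \<preceq> y \<boxdot> g k" "y \<boxdot> f k \<preceq> x \<boxdot> g k"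
      unfolding P_def by blast
    have c: "c \<boxdot> f k \<preceq> c \<boxdot> g k"
      using xyc f g fg by (intro smul_mono) (auto simp: idem)
    have "(x \<boxplus> c) \<boxdot> f k \<preceq> (y \<boxplus> c) \<boxdot> g k"
      using sadd_mono[OF k(1) c] xyc f(1) g(1) by (simp add: distrib_right smul_closed)
    moreover have "(y \<boxplus> c) \<boxdot> f k \<preceq> (x \<boxplus> c) \<boxdot> g k"
      using sadd_mono[OF k(2) c] xyc f(1) g(1) by (simp add: distrib_right smul_closed)
    ultimately show "P (x \<boxplus> c) (y \<boxplus> c)"
      unfolding P_def by blast
    have "c \<boxdot> (x \<boxdot> f k) \<preceq> c \<boxdot> (y \<boxdot> g k)" "c \<boxdot> (y \<boxdot> f k) \<preceq> c \<boxdot> (x \<boxdot> g k)"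
      using k xyc f(1) g(1) by (auto simp: ple_smul_cancel smul_closed)
    then show "P (x \<boxdot> c) (y \<boxdot> c)"
      unfolding P_def using xyc f(1) g(1) by (metis smul_assoc smul_commute)
  qed
  \<comment> \<open>At exponent 1 the first inequality is monotonicity; the two sides of the second
    are equal by commutativity.\<close>
  moreover have "P (f 1) (g 1)"
    unfolding P_def
  proof (intro exI[of _ 1] conjI)
    show "f 1 \<boxdot> f 1 \<preceq> g 1 \<boxdot> g 1"
      using f g fg by (intro smul_mono) auto
    show "g 1 \<boxdot> f 1 \<preceq> f 1 \<boxdot> g 1"
      by (metis f(1) g(1) idem smul_closed smul_commute)
  qed
  ultimately have "P x y"
    using ne f(1)[of 1] g(1)[of 1] x y by blast
  then show ?thesis
    unfolding P_def by blast
qed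

end

section \<open>Embedding into the max-plus semiring\<close>

context cancellative_simple_srg
begin

text \<open>After multiplication by a fixed element \<open>u\<close>, the members of the monoid with adjoined unit
  are compared inside \<open>S\<close>.\<close>

definition scaled :: "'a \<Rightarrow> 'a option \<Rightarrow> 'a" where
  "scaled u x = (case x of None \<Rightarrow> u | Some a \<Rightarrow> a \<boxdot> u)"

context
  fixes u
  assumes u: "u \<in> carrier S"
begin

interpretation M: comm_monoid "adjoin_unit S"
  by (rule comm_monoid_adjoin_unit)

lemma scaled_closed: "x \<in> carrier (adjoin_unit S) \<Longrightarrow> scaled u x \<in> carrier S"
  using u by (auto simp: adjoin_unit_def scaled_def smul_closed)

lemma scaled_mult:
  "\<lbrakk>x \<in> carrier (adjoin_unit S); y \<in> carrier (adjoin_unit S)\<rbrakk>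
    \<Longrightarrow> u \<boxdot> scaled u (x \<otimes>\<^bsub>adjoin_unit S\<^esub> y) = scaled u x \<boxdot> scaled u y"
  using u by (auto simp: adjoin_unit_def scaled_def smul_closed smul_ac)

lemma scaled_ple_iff:
  "\<lbrakk>x \<in> carrier (adjoin_unit S); y \<in> carrier (adjoin_unit S);
    x' \<in> carrier (adjoin_unit S); y' \<in> carrier (adjoin_unit S)\<rbrakk>
    \<Longrightarrow> scaled u (x \<otimes>\<^bsub>adjoin_unit S\<^esub> y) \<preceq> scaled u (x' \<otimes>\<^bsub>adjoin_unit S\<^esub> y')
      \<longleftrightarrow> scaled u x \<boxdot> scaled u y \<preceq> scaled u x' \<boxdot> scaled u y'"
  by (metis M.m_closed ple_smul_cancel scaled_closed scaled_mult u)

lemma scaled_archimedean: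
  assumes pq: "scaled u p \<preceq> scaled u q" "scaled u p \<noteq> scaled u q"
    and p: "p \<in> carrier (adjoin_unit S)" and q: "q \<in> carrier (adjoin_unit S)"
    and x: "x \<in> carrier (adjoin_unit S)" and y: "y \<in> carrier (adjoin_unit S)"
  shows "\<exists>k::nat. scaled u (x \<otimes>\<^bsub>adjoin_unit S\<^esub> p [^]\<^bsub>adjoin_unit S\<^esub> k)
    \<preceq> scaled u (y \<otimes>\<^bsub>adjoin_unit S\<^esub> q [^]\<^bsub>adjoin_unit S\<^esub> k)"
proof -
  have pow: "scaled u (p [^]\<^bsub>adjoin_unit S\<^esub> k) \<preceq> scaled u (q [^]\<^bsub>adjoin_unit S\<^esub> k)" for k :: nat
  proof (induction k)
    case 0
    show ?case
      using scaled_closed[OF M.one_closed] by (simp add: idem)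
  next
    case (Suc k)
    then show ?case
      using pq p q smul_mono scaled_closed by (simp add: scaled_ple_iff)
  qed
  have "\<exists>k. scaled u x \<boxdot> scaled u (p [^]\<^bsub>adjoin_unit S\<^esub> k)
      \<preceq> scaled u y \<boxdot> scaled u (q [^]\<^bsub>adjoin_unit S\<^esub> (k::nat))"
    using p q x y pq pow
    by (intro simple_archimedean[OF u])
      (auto simp: scaled_closed M.nat_pow_mult[symmetric] scaled_mult)
  then show ?thesis
    using p q x y by (simp add: scaled_ple_iff)
qed

text \<open>With \<open>c = a + b\<close>, the inequality \<open>c a\<^sup>k \<le> b c\<^sup>k\<close> descends to \<open>k = 0\<close>:
  \<open>c a\<^sup>j (a + b) \<le> b c\<^sup>j\<^sup>+\<^sup>1\<close>, because \<open>a \<le> c\<close>, and \<open>c\<close> cancels.\<close>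

lemma ple_total:
  assumes a: "a \<in> carrier S" and b: "b \<in> carrier S"
  shows "a \<preceq> b \<or> b \<preceq> a"
proof (rule ccontr)
  assume not: "\<not> ?thesis"
  let ?c = "a \<boxplus> b"
  let ?pow = "\<lambda>x k::nat. scaled u (Some x [^]\<^bsub>adjoin_unit S\<^esub> k)"
  have c: "?c \<in> carrier S"
    using a b by (rule sadd_closed)
  have Some: "Some x \<in> carrier (adjoin_unit S)" if "x \<in> carrier S" for x
    using that by (simp add: adjoin_unit_def)
  have pow_closed: "?pow x k \<in> carrier S" if "x \<in> carrier S" for x k
    using that Some scaled_closed by simp
  have pow_Suc: "?pow x (Suc k) = x \<boxdot> ?pow x k" if x: "x \<in> carrier S" for x k
  proof -
    have "u \<boxdot> ?pow x (Suc k) = ?pow x k \<boxdot> (x \<boxdot> u)"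
      using scaled_mult[of "Some x [^]\<^bsub>adjoin_unit S\<^esub> k" "Some x"] Some[OF x] by (simp add: scaled_def)
    also have "\<dots> = u \<boxdot> (x \<boxdot> ?pow x k)"
      using pow_closed[OF x] x u by (simp add: smul_ac smul_closed)
    finally show ?thesis
      using cancel u pow_closed[OF x] x smul_closed by blast
  qed
  have pow_mono: "?pow a k \<preceq> ?pow ?c k" for k
  proof (induction k)
    case 0
    show ?case
      using u by (simp add: scaled_def adjoin_unit_def idem)
  next
    case (Suc k)
    then show ?case
      unfolding pow_Suc[OF a] pow_Suc[OF c]
      using a b c pow_closed[OF a] pow_closed[OF c] ple_sadd1 by (intro smul_mono) auto
  qed
  have ne: "?pow a 1 \<noteq> ?pow ?c 1"
  proof
    assume "?pow a 1 = ?pow ?c 1"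
    then have "u \<boxdot> a = u \<boxdot> ?c"
      using pow_Suc[OF a, of 0] pow_Suc[OF c, of 0] a c u
      by (simp add: scaled_def adjoin_unit_def smul_commute)
    then have "b \<preceq> a"
      using cancel u a b c sadd_commute by metis
    with not show False
      by blast
  qed
  have mult: "u \<boxdot> ?pow x (k + m) = ?pow x k \<boxdot> ?pow x m" if "x \<in> carrier S" for x k m
    using scaled_mult[of "Some x [^]\<^bsub>adjoin_unit S\<^esub> k" "Some x [^]\<^bsub>adjoin_unit S\<^esub> m"] Some[OF that]
    by (simp add: M.nat_pow_mult)
  \<comment> \<open>The strict pair is \<open>a\<close> and \<open>a + b\<close>, distinct because
    \<open>b \<preceq> a\<close> fails; the outer factors are \<open>a + b\<close> and
    \<open>b\<close>.\<close>
  obtain k where "?c \<boxdot> ?pow a k \<preceq> b \<boxdot> ?pow ?c k"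
    using simple_archimedean[of u "?pow a" "?pow ?c" ?c b]
      u pow_closed[OF a] pow_closed[OF c] mult[OF a] mult[OF c] pow_mono ne c b by blast
  then have "?c \<boxdot> ?pow a 0 \<preceq> b \<boxdot> ?pow ?c 0"
  proof (induction k)
    case (Suc k)
    let ?s = "?c \<boxdot> ?pow a k" and ?t = "b \<boxdot> ?pow ?c k"
    have st: "?s \<in> carrier S" "?t \<in> carrier S"
      using a b c pow_closed smul_closed by auto
    have "?c \<boxdot> ?pow a (Suc k) = a \<boxdot> ?s"
      unfolding pow_Suc[OF a] using c a pow_closed[OF a] by (rule smul_lcomm)
    moreover have t: "b \<boxdot> ?pow ?c (Suc k) = ?c \<boxdot> ?t"
      unfolding pow_Suc[OF c] using b c pow_closed[OF c] by (rule smul_lcomm)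
    ultimately have 1: "a \<boxdot> ?s \<preceq> ?c \<boxdot> ?t"
      using Suc.prems by simp
    have "b \<boxdot> ?s = ?c \<boxdot> (b \<boxdot> ?pow a k)"
      using b c pow_closed[OF a] by (rule smul_lcomm)
    moreover have "?c \<boxdot> (b \<boxdot> ?pow a k) \<preceq> ?c \<boxdot> ?t"
      using pow_mono[of k] b c pow_closed[OF a] pow_closed[OF c]
      by (simp add: ple_smul_cancel smul_closed)
    ultimately have 2: "b \<boxdot> ?s \<preceq> ?c \<boxdot> ?t"
      by simp
    have ct: "?c \<boxdot> ?t \<in> carrier S"
      using c st by (simp add: smul_closed)
    have "a \<boxdot> ?s \<boxplus> b \<boxdot> ?s \<preceq> ?c \<boxdot> ?t \<boxplus> ?c \<boxdot> ?t"
      by (rule sadd_mono[OF 1 2]) (use a b ct st in \<open>auto simp: smul_closed\<close>)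
    then have "?c \<boxdot> ?s \<preceq> ?c \<boxdot> ?t"
      unfolding distrib_right[OF a b st(1)] idem[OF ct] .
    then have "?s \<preceq> ?t"
      using c st by (simp add: ple_smul_cancel)
    then show ?case
      by (rule Suc.IH)
  qed
  then have "u \<boxdot> ?c \<preceq> u \<boxdot> b"
    using u b c by (simp add: scaled_def adjoin_unit_def smul_commute)
  then have "?c \<preceq> b"
    using u b c by (simp add: ple_smul_cancel)
  then have "a \<preceq> b"
    using ple_trans[of a ?c b] ple_sadd1[OF a b] a b c by blast
  with not show False
    by blast
qed

lemma archimedean_adjoin_unit:
  "archimedean_comm_monoid (adjoin_unit S) (\<lambda>x y. scaled u x \<preceq> scaled u y)"
proof
  fix x y
  assume "x \<in> carrier (adjoin_unit S)" "y \<in> carrier (adjoin_unit S)"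
  then show "scaled u x \<preceq> scaled u y \<or> scaled u y \<preceq> scaled u x"
    using ple_total scaled_closed by blast
next
  fix x y z
  assume "scaled u x \<preceq> scaled u y" "scaled u y \<preceq> scaled u z" "x \<in> carrier (adjoin_unit S)"
    "y \<in> carrier (adjoin_unit S)" "z \<in> carrier (adjoin_unit S)"
  then show "scaled u x \<preceq> scaled u z"
    using ple_trans scaled_closed by blast
next
  fix x y z
  assume "x \<in> carrier (adjoin_unit S)" "y \<in> carrier (adjoin_unit S)" "z \<in> carrier (adjoin_unit S)"
  then show "scaled u (x \<otimes>\<^bsub>adjoin_unit S\<^esub> z) \<preceq> scaled u (y \<otimes>\<^bsub>adjoin_unit S\<^esub> z)
    \<longleftrightarrow> scaled u x \<preceq> scaled u y"
    using ple_smul_cancel[of "scaled u z" "scaled u x" "scaled u y"] scaled_closed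
    by (simp add: scaled_ple_iff smul_commute[of _ "scaled u z"])
next
  fix p q x y
  assume *: "\<not> scaled u q \<preceq> scaled u p" "p \<in> carrier (adjoin_unit S)" "q \<in> carrier (adjoin_unit S)"
    and xy: "x \<in> carrier (adjoin_unit S)" "y \<in> carrier (adjoin_unit S)"
  then have "scaled u p \<preceq> scaled u q" "scaled u p \<noteq> scaled u q"
    using ple_total scaled_closed idem by metis+
  with * xy show "\<exists>k::nat. scaled u (x \<otimes>\<^bsub>adjoin_unit S\<^esub> p [^]\<^bsub>adjoin_unit S\<^esub> k)
    \<preceq> scaled u (y \<otimes>\<^bsub>adjoin_unit S\<^esub> q [^]\<^bsub>adjoin_unit S\<^esub> k)"
    by (intro scaled_archimedean)
qed

end

text \<open>Restricted to \<open>S\<close>, the preorder of the enlarged monoid is the natural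
  order, since \<open>u\<close> cancels. Totality turns its joins into maxima, and antisymmetry on
  \<open>S\<close> gives injectivity.\<close>

lemma ex_max_plus_embedding:
  obtains \<phi> :: "'a \<Rightarrow> real" where "inj_on \<phi> (carrier S)"
    "\<And>a b. \<lbrakk>a \<in> carrier S; b \<in> carrier S\<rbrakk> \<Longrightarrow> \<phi> (a \<boxplus> b) = max (\<phi> a) (\<phi> b)"
    "\<And>a b. \<lbrakk>a \<in> carrier S; b \<in> carrier S\<rbrakk> \<Longrightarrow> \<phi> (a \<boxdot> b) = \<phi> a + \<phi> b"
proof -
  obtain u where u: "u \<in> carrier S"
    using nonempty by blast
  interpret archimedean_comm_monoid "adjoin_unit S" "\<lambda>x y. scaled u x \<preceq> scaled u y"
    using u by (rule archimedean_adjoin_unit)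
  obtain \<psi> :: "'a option \<Rightarrow> real" where \<psi>: "\<forall>x \<in> carrier (adjoin_unit S). \<forall>y \<in> carrier (adjoin_unit S).
      \<psi> (x \<otimes>\<^bsub>adjoin_unit S\<^esub> y) = \<psi> x + \<psi> y \<and> (scaled u x \<preceq> scaled u y \<longleftrightarrow> \<psi> x \<le> \<psi> y)"
    using ex_real_embedding by blast
  define \<phi> where "\<phi> a = \<psi> (Some a)" for a
  have mult: "\<phi> (a \<boxdot> b) = \<phi> a + \<phi> b" and le: "a \<preceq> b \<longleftrightarrow> \<phi> a \<le> \<phi> b"
    if "a \<in> carrier S" "b \<in> carrier S" for a b
  proof -
    have "Some a \<in> carrier (adjoin_unit S)" "Some b \<in> carrier (adjoin_unit S)"
      using that by (auto simp: adjoin_unit_def)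
    then have "\<psi> (Some a \<otimes>\<^bsub>adjoin_unit S\<^esub> Some b) = \<psi> (Some a) + \<psi> (Some b)"
      "scaled u (Some a) \<preceq> scaled u (Some b) \<longleftrightarrow> \<psi> (Some a) \<le> \<psi> (Some b)"
      using \<psi> by blast+
    then show "\<phi> (a \<boxdot> b) = \<phi> a + \<phi> b" "a \<preceq> b \<longleftrightarrow> \<phi> a \<le> \<phi> b"
      using that u ple_smul_cancel[of u a b]
      by (simp_all add: \<phi>_def adjoin_unit_def scaled_def smul_commute)
  qed
  show ?thesis
  proof (rule that[of \<phi>])
    show "inj_on \<phi> (carrier S)"
      using le ple_antisym by (intro inj_onI) (metis order_refl)
    show "\<phi> (a \<boxplus> b) = max (\<phi> a) (\<phi> b)" if "a \<in> carrier S" "b \<in> carrier S" for a b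
      using ple_total[OF u that]
    proof
      assume "a \<preceq> b"
      then show ?thesis
        using le[OF that] by (simp add: max_absorb2)
    next
      assume "b \<preceq> a"
      then show ?thesis
        using le[of b a] that sadd_commute[OF that] by (simp add: max_absorb1)
    qed
  qed (fact mult)
qed

end

text \<open>The embedding is a parameter, so the same facts serve both directions: for the map
  obtained from Hoelder's theorem and for a given isomorphism onto a set of reals.\<close>

locale max_plus_srg = comm_srg +
  fixes \<phi> :: "'a \<Rightarrow> real"
  assumes \<phi>_inj: "inj_on \<phi> (carrier S)"
    and \<phi>_sadd: "\<lbrakk>a \<in> carrier S; b \<in> carrier S\<rbrakk> \<Longrightarrow> \<phi> (a \<boxplus> b) = max (\<phi> a) (\<phi> b)"
    and \<phi>_smul: "\<lbrakk>a \<in> carrier S; b \<in> carrier S\<rbrakk> \<Longrightarrow> \<phi> (a \<boxdot> b) = \<phi> a + \<phi> b"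
begin

lemma \<phi>_eq_iff: "\<lbrakk>a \<in> carrier S; b \<in> carrier S\<rbrakk> \<Longrightarrow> \<phi> a = \<phi> b \<longleftrightarrow> a = b"
  using \<phi>_inj by (auto dest: inj_onD)

sublocale idem_comm_srg
  by standard (metis \<phi>_eq_iff \<phi>_sadd max.idem sadd_closed)

lemma ple_iff: "\<lbrakk>a \<in> carrier S; b \<in> carrier S\<rbrakk> \<Longrightarrow> a \<preceq> b \<longleftrightarrow> \<phi> a \<le> \<phi> b"
  using \<phi>_eq_iff[of "a \<boxplus> b" b] by (auto simp: \<phi>_sadd sadd_closed max_def split: if_splits)

lemma ex_\<phi>_less:
  assumes "congruence_simple S"
  obtains a b where "a \<in> carrier S" "b \<in> carrier S" "\<phi> a < \<phi> b"
proof -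
  obtain a b where ab: "a \<in> carrier S" "b \<in> carrier S" "a \<noteq> b"
    using assms simple_iff by blast
  then have "\<phi> a < \<phi> b \<or> \<phi> b < \<phi> a"
    using \<phi>_eq_iff by (meson linorder_less_linear)
  with ab show ?thesis
    using that by blast
qed

text \<open>If all values are nonpositive, the elements with value at most \<open>\<phi> a\<close>
  are stable under every multiplication. Collapsing them is compatible with adding \<open>c\<close>:
  if \<open>\<phi> c\<close> exceeds \<open>\<phi> a\<close>, each of them becomes \<open>c\<close>,
  otherwise the sums stay in the set. Since \<open>b\<close> lies outside it, the congruence is
  proper.\<close>

lemma simple_imp_ex_pos:
  assumes simple: "congruence_simple S"
  shows "\<exists>a \<in> carrier S. \<phi> a > 0"
proof (rule ccontr)
  assume "\<not> ?thesis"
  then have nonpos: "\<phi> x \<le> 0" if "x \<in> carrier S" for x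
    using that by force
  obtain a b where ab: "a \<in> carrier S" "b \<in> carrier S" "\<phi> a < \<phi> b"
    using ex_\<phi>_less[OF simple] .
  define P where "P x y \<longleftrightarrow> x = y \<or> \<phi> x \<le> \<phi> a \<and> \<phi> y \<le> \<phi> a" for x y
  have "(\<forall>x \<in> carrier S. \<forall>y \<in> carrier S. P x y \<longrightarrow> x = y)
    \<or> (\<forall>x \<in> carrier S. \<forall>y \<in> carrier S. P x y)"
    using simple
  proof (rule simple_cases)
    fix x y c
    assume P: "P x y" and xyc: "x \<in> carrier S" "y \<in> carrier S" "c \<in> carrier S"
    have "x \<boxplus> c = c \<and> y \<boxplus> c = c" if "\<phi> a < \<phi> c" "x \<noteq> y"
      using P that xyc unfolding P_def by (auto simp: ple_iff)
    then show "P (x \<boxplus> c) (y \<boxplus> c)"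
      using P xyc unfolding P_def by (cases "\<phi> a < \<phi> c"; cases "x = y") (auto simp: \<phi>_sadd)
    show "P (x \<boxdot> c) (y \<boxdot> c)"
      using P xyc nonpos[of c] unfolding P_def by (auto simp: \<phi>_smul)
  qed (auto simp: P_def)
  moreover have "P a (a \<boxdot> a)"
    using ab nonpos[of a] by (auto simp: P_def \<phi>_smul)
  \<comment> \<open>From \<open>\<phi> a < \<phi> b \<le> 0\<close>, squaring moves \<open>a\<close>
    strictly down.\<close>
  moreover have "a \<noteq> a \<boxdot> a"
    using ab nonpos[of b] \<phi>_smul[of a a] by auto
  moreover have "\<not> P b a"
    using ab by (auto simp: P_def)
  ultimately show False
    using ab smul_closed by blast
qed

text \<open>If all values are nonnegative, the elements with value at least \<open>\<phi> b\<close>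
  absorb both operations and can be collapsed. Here \<open>\<phi> b\<close> is positive, so
  \<open>b\<close> and its square differ, while \<open>a\<close> lies outside.\<close>

lemma simple_imp_ex_neg:
  assumes simple: "congruence_simple S"
  shows "\<exists>a \<in> carrier S. \<phi> a < 0"
proof (rule ccontr)
  assume "\<not> ?thesis"
  then have nonneg: "\<phi> x \<ge> 0" if "x \<in> carrier S" for x
    using that by force
  obtain a b where ab: "a \<in> carrier S" "b \<in> carrier S" "\<phi> a < \<phi> b"
    using ex_\<phi>_less[OF simple] .
  define P where "P x y \<longleftrightarrow> x = y \<or> \<phi> x \<ge> \<phi> b \<and> \<phi> y \<ge> \<phi> b" for x y
  have "(\<forall>x \<in> carrier S. \<forall>y \<in> carrier S. P x y \<longrightarrow> x = y)
    \<or> (\<forall>x \<in> carrier S. \<forall>y \<in> carrier S. P x y)"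
    using simple
  proof (rule simple_cases)
    fix x y c
    assume P: "P x y" and xyc: "x \<in> carrier S" "y \<in> carrier S" "c \<in> carrier S"
    show "P (x \<boxplus> c) (y \<boxplus> c)"
      using P xyc unfolding P_def by (auto simp: \<phi>_sadd)
    show "P (x \<boxdot> c) (y \<boxdot> c)"
      using P xyc nonneg[of c] unfolding P_def by (auto simp: \<phi>_smul)
  qed (auto simp: P_def)
  moreover have "P b (b \<boxdot> b)"
    using ab nonneg[of b] by (auto simp: P_def \<phi>_smul)
  moreover have "b \<noteq> b \<boxdot> b"
    using ab nonneg[of a] \<phi>_smul[of b b] by auto
  moreover have "\<not> P b a"
    using ab by (auto simp: P_def)
  ultimately show False
    using ab smul_closed by blast
qed

end

lemma (in cancellative_simple_srg) isomorphic_max_plus: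
  "\<exists>A. subsemiring A R_max_plus \<and> A \<inter> {0<..} \<noteq> {} \<and> A \<inter> {..<0} \<noteq> {} \<and>
    srg_isomorphic S (R_max_plus\<lparr>carrier := A\<rparr>)"
proof -
  obtain \<phi> :: "'a \<Rightarrow> real" where \<phi>: "inj_on \<phi> (carrier S)"
    "\<And>a b. \<lbrakk>a \<in> carrier S; b \<in> carrier S\<rbrakk> \<Longrightarrow> \<phi> (a \<boxplus> b) = max (\<phi> a) (\<phi> b)"
    "\<And>a b. \<lbrakk>a \<in> carrier S; b \<in> carrier S\<rbrakk> \<Longrightarrow> \<phi> (a \<boxdot> b) = \<phi> a + \<phi> b"
    by (rule ex_max_plus_embedding) (rule that, auto)
  interpret max_plus_srg S \<phi>
    by standard (fact \<phi>)+
  have "subsemiring (\<phi> ` carrier S) R_max_plus"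
    using nonempty
    by (auto simp: subsemiring_def R_max_plus_def \<phi>_sadd[symmetric] \<phi>_smul[symmetric]
        intro!: imageI sadd_closed smul_closed)
  moreover have "\<phi> ` carrier S \<inter> {0<..} \<noteq> {}" "\<phi> ` carrier S \<inter> {..<0} \<noteq> {}"
    using simple_imp_ex_pos simple_imp_ex_neg simple by auto
  moreover have "srg_isomorphic S (R_max_plus\<lparr>carrier := \<phi> ` carrier S\<rparr>)"
    unfolding srg_isomorphic_def using \<phi>_inj \<phi>_sadd \<phi>_smul
    by (intro exI[of _ \<phi>]) (auto simp: R_max_plus_def bij_betw_def)
  ultimately show ?thesis
    by blast
qed

lemma (in idem_comm_srg) simple_imp_isomorphic:
  assumes simple: "congruence_simple S" and "card (product_set S) \<noteq> 1"
    and "\<not> (\<exists>w. bi_absorbing S w)"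
  shows "srg_isomorphic S L2 \<or>
    (\<exists>A. subsemiring A R_max_plus \<and> A \<inter> {0<..} \<noteq> {} \<and> A \<inter> {..<0} \<noteq> {} \<and>
      srg_isomorphic S (R_max_plus\<lparr>carrier := A\<rparr>))"
  using simple
proof (cases rule: simple_cancellative_or_absorbing)
  case cancel
  then interpret cancellative_simple_srg S
    using simple by unfold_locales blast+
  show ?thesis
    using isomorphic_max_plus by blast
next
  case (absorb z)
  then show ?thesis
    using absorbing_imp_L2 assms by blast
qed

section \<open>Matrix semirings\<close>

context srg
begin

lemma srg_sum_closed: "(\<And>k. k \<le> m \<Longrightarrow> f k \<in> carrier S) \<Longrightarrow> srg_sum S f m \<in> carrier S"
  by (induction m) (auto intro: sadd_closed)

lemma srg_sum_congruence:
  assumes "srg_congruence S r"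
  shows "(\<And>k. k \<le> m \<Longrightarrow> (f k, g k) \<in> r) \<Longrightarrow> (srg_sum S f m, srg_sum S g m) \<in> r"
proof (induction m)
  case (Suc m)
  then show ?case
    using assms unfolding srg_congruence_def by auto
qed simp

lemma mat_carrier_iff:
  "A \<in> carrier (mat_srg n S) \<longleftrightarrow> A \<in> carrier_mat n n \<and> (\<forall>i<n. \<forall>j<n. A $$ (i, j) \<in> carrier S)"
  unfolding mat_srg_def by (auto dest: elements_matD intro: elements_matI)

lemma mat_eqI:
  assumes "A \<in> carrier (mat_srg n S)" "B \<in> carrier (mat_srg n S)"
    and "\<And>i j. \<lbrakk>i < n; j < n\<rbrakk> \<Longrightarrow> A $$ (i, j) = B $$ (i, j)"
  shows "A = B"
  using assms by (intro eq_matI) (auto simp: mat_carrier_iff)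

lemma mat_sadd_index:
  "\<lbrakk>i < n; j < n\<rbrakk> \<Longrightarrow> (A \<boxplus>\<^bsub>mat_srg n S\<^esub> B) $$ (i, j) = A $$ (i, j) \<boxplus> B $$ (i, j)"
  by (simp add: mat_srg_def)

lemma mat_smul_index:
  "\<lbrakk>i < n; j < n\<rbrakk> \<Longrightarrow> (A \<boxdot>\<^bsub>mat_srg n S\<^esub> B) $$ (i, j)
    = srg_sum S (\<lambda>k. A $$ (i, k) \<boxdot> B $$ (k, j)) (n - 1)"
  by (simp add: mat_srg_def)

lemma mat_carrier_dims:
  "A \<boxplus>\<^bsub>mat_srg n S\<^esub> B \<in> carrier_mat n n" "A \<boxdot>\<^bsub>mat_srg n S\<^esub> B \<in> carrier_mat n n"
  by (simp_all add: mat_srg_def)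

lemma mat_sadd_closed:
  "\<lbrakk>A \<in> carrier (mat_srg n S); B \<in> carrier (mat_srg n S)\<rbrakk>
    \<Longrightarrow> A \<boxplus>\<^bsub>mat_srg n S\<^esub> B \<in> carrier (mat_srg n S)"
  by (auto simp: mat_carrier_iff mat_sadd_index mat_carrier_dims sadd_closed)

lemma mat_smul_closed:
  "\<lbrakk>A \<in> carrier (mat_srg n S); B \<in> carrier (mat_srg n S)\<rbrakk>
    \<Longrightarrow> A \<boxdot>\<^bsub>mat_srg n S\<^esub> B \<in> carrier (mat_srg n S)"
  by (auto simp: mat_carrier_iff mat_smul_index mat_carrier_dims intro!: srg_sum_closed smul_closed)

lemma mat_simple_iff:
  "congruence_simple (mat_srg n S)
    \<longleftrightarrow> (\<exists>A \<in> carrier (mat_srg n S). \<exists>B \<in> carrier (mat_srg n S). A \<noteq> B) \<and>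
      (\<forall>r. srg_congruence (mat_srg n S) r
        \<longrightarrow> r = Id_on (carrier (mat_srg n S)) \<or> r = carrier (mat_srg n S) \<times> carrier (mat_srg n S))"
  by (rule congruence_simple_iff) (simp add: mat_sadd_closed mat_smul_closed)

lemma const_mat_carrier_iff:
  "n > 0 \<Longrightarrow> mat n n (\<lambda>_. c) \<in> carrier (mat_srg n S) \<longleftrightarrow> c \<in> carrier S"
  by (auto simp: mat_carrier_iff)

lemma const_mat_eq_iff: "n > 0 \<Longrightarrow> mat n n (\<lambda>_. c) = mat n n (\<lambda>_. d) \<longleftrightarrow> c = d"
  by (metis index_mat(1) split_conv)

lemma mat_simpleD:
  assumes "congruence_simple (mat_srg n S)" "srg_congruence (mat_srg n S) r"
    and "(A, B) \<in> r" "A \<noteq> B" "X \<in> carrier (mat_srg n S)" "Y \<in> carrier (mat_srg n S)"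
  shows "(X, Y) \<in> r"
proof -
  have "r = Id_on (carrier (mat_srg n S)) \<or> r = carrier (mat_srg n S) \<times> carrier (mat_srg n S)"
    using assms mat_simple_iff by blast
  then show ?thesis
    using assms(3-) by (auto simp: Id_on_iff)
qed

lemma srg_congruence_entrywise:
  assumes r: "srg_congruence S r" and n: "n > 0"
  shows "srg_congruence (mat_srg n S) {(A, B). A \<in> carrier (mat_srg n S) \<and> B \<in> carrier (mat_srg n S) \<and>
    (\<forall>i<n. \<forall>j<n. (A $$ (i, j), B $$ (i, j)) \<in> r)}"
    (is "srg_congruence _ ?R")
  unfolding srg_congruence_def
proof (intro conjI allI impI)
  have equiv: "equiv (carrier S) r"
    using r by (simp add: srg_congruence_def)
  then have rel: "refl_on (carrier S) r" "sym r" "trans r"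
    by (auto simp: equiv_def)
  show "equiv (carrier (mat_srg n S)) ?R"
  proof (intro equivI refl_onI symI transI)
    fix A B C
    assume "(A, B) \<in> ?R" "(B, C) \<in> ?R"
    then show "(A, C) \<in> ?R"
      using transD[OF rel(3)] by simp blast
  next
    fix A B
    assume "(A, B) \<in> ?R"
    then show "(B, A) \<in> ?R"
      using symD[OF rel(2)] by simp
  qed (use refl_onD[OF rel(1)] in \<open>auto simp: mat_carrier_iff\<close>)
  fix A B C D
  assume "(A, B) \<in> ?R" "(C, D) \<in> ?R"
  then show "(A \<boxplus>\<^bsub>mat_srg n S\<^esub> C, B \<boxplus>\<^bsub>mat_srg n S\<^esub> D) \<in> ?R"
    using r by (auto simp: mat_sadd_closed mat_sadd_index srg_congruence_def)
  have "(A $$ (i, k) \<boxdot> C $$ (k, j), B $$ (i, k) \<boxdot> D $$ (k, j)) \<in> r"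
    if "i < n" "j < n" "k \<le> n - 1" for i j k
    using \<open>(A, B) \<in> ?R\<close> \<open>(C, D) \<in> ?R\<close> that n r unfolding srg_congruence_def by auto
  then show "(A \<boxdot>\<^bsub>mat_srg n S\<^esub> C, B \<boxdot>\<^bsub>mat_srg n S\<^esub> D) \<in> ?R"
    using \<open>(A, B) \<in> ?R\<close> \<open>(C, D) \<in> ?R\<close> r
    by (auto simp: mat_smul_closed mat_smul_index intro!: srg_sum_congruence)
qed

text \<open>A congruence of \<open>S\<close> lifts entrywise. Distinct related elements give
  distinct related constant matrices, so the lift is full, and comparing constant matrices shows
  that the original congruence is full.\<close>

lemma mat_simple_imp_simple:
  assumes simple: "congruence_simple (mat_srg n S)" and n: "n > 0"
  shows "congruence_simple S"
proof -
  obtain A B where AB: "A \<in> carrier (mat_srg n S)" "B \<in> carrier (mat_srg n S)" "A \<noteq> B"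
    using simple mat_simple_iff by blast
  then obtain i j where "i < n" "j < n" "A $$ (i, j) \<noteq> B $$ (i, j)"
    using mat_eqI by blast
  then have nontriv: "\<exists>a \<in> carrier S. \<exists>b \<in> carrier S. a \<noteq> b"
    using AB by (auto simp: mat_carrier_iff)
  moreover have "r = Id_on (carrier S) \<or> r = carrier S \<times> carrier S" if r: "srg_congruence S r" for r
  proof (cases "\<exists>a b. (a, b) \<in> r \<and> a \<noteq> b")
    case True
    then obtain a b where ab: "(a, b) \<in> r" "a \<noteq> b"
      by blast
    have sub: "r \<subseteq> carrier S \<times> carrier S"
      using r by (simp add: srg_congruence_def equiv_def)
    have "(x, y) \<in> r" if "x \<in> carrier S" "y \<in> carrier S" for x y
    proof -
      let ?R = "{(A, B). A \<in> carrier (mat_srg n S) \<and> B \<in> carrier (mat_srg n S) \<and>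
        (\<forall>i<n. \<forall>j<n. (A $$ (i, j), B $$ (i, j)) \<in> r)}"
      have "(mat n n (\<lambda>_. x), mat n n (\<lambda>_. y)) \<in> ?R"
      proof (rule mat_simpleD[OF simple])
        show "srg_congruence (mat_srg n S) ?R"
          using r n by (rule srg_congruence_entrywise)
        show "(mat n n (\<lambda>_. a), mat n n (\<lambda>_. b)) \<in> ?R"
          using ab sub n by (auto simp: const_mat_carrier_iff)
      qed (use that ab n in \<open>auto simp: const_mat_carrier_iff const_mat_eq_iff\<close>)
      then show ?thesis
        using n by auto
    qed
    then show ?thesis
      using sub by auto
  next
    case False
    then show ?thesis
      using r by (auto simp: srg_congruence_def equiv_def refl_on_def)
  qed
  ultimately show ?thesis
    using simple_iff by blast
qed

end

section \<open>Obstructions to simplicity of matrix semirings\<close>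

context idem_comm_srg
begin

text \<open>Sums are joins, so a greatest summand is the sum. This is how entries of matrix products
  are evaluated below.\<close>

lemma srg_sum_eqI:
  assumes f: "\<And>k. k \<le> m \<Longrightarrow> f k \<in> carrier S" and j: "j \<le> m"
    and max: "\<And>k. k \<le> m \<Longrightarrow> f k \<preceq> f j"
  shows "srg_sum S f m = f j"
proof (rule ple_antisym)
  have "l \<le> m \<Longrightarrow> srg_sum S f l \<preceq> f j" for l
  proof (induction l)
    case (Suc l)
    then have "srg_sum S f l \<in> carrier S"
      using f by (intro srg_sum_closed) auto
    then show ?case
      using Suc f j max[of "Suc l"] sadd_assoc by simp
  qed (use max in simp)
  then show "srg_sum S f m \<preceq> f j"
    by simp
  have "\<lbrakk>j \<le> l; l \<le> m\<rbrakk> \<Longrightarrow> f j \<preceq> srg_sum S f l" for l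
  proof (induction l)
    case 0
    then show ?case
      using f idem by simp
  next
    case (Suc l)
    then have l: "srg_sum S f l \<in> carrier S" "f (Suc l) \<in> carrier S"
      using f by (auto intro!: srg_sum_closed)
    show ?case
    proof (cases "j = Suc l")
      case True
      then show ?thesis
        using ple_sadd2 l by simp
    next
      case False
      then have "f j \<preceq> srg_sum S f l"
        using Suc by simp
      then show ?thesis
        using ple_sadd1[OF l] ple_trans[of "f j" "srg_sum S f l"] l f[OF j] sadd_closed by simp
    qed
  qed
  then show "f j \<preceq> srg_sum S f m"
    using j by simp
qed (use f j srg_sum_closed in auto)

text \<open>With constant multiplication in \<open>S\<close>, all matrix products coincide, so every
  equivalence compatible with addition is a congruence. Agreement in the entry \<open>(0, 0)\<close>
  is one, and it is proper.\<close>

lemma mat_simple_imp_product_set: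
  assumes simple: "congruence_simple (mat_srg n S)" and n: "n \<ge> 2"
  shows "card (product_set S) \<noteq> 1"
proof
  let ?M = "carrier (mat_srg n S)"
  assume "card (product_set S) = 1"
  then obtain c where c: "product_set S = {c}"
    by (auto simp: card_1_singleton_iff)
  then have prod: "x \<boxdot> y = c" if "x \<in> carrier S" "y \<in> carrier S" for x y
    using that unfolding product_set_def by auto
  have mat_prod: "A \<boxdot>\<^bsub>mat_srg n S\<^esub> C = B \<boxdot>\<^bsub>mat_srg n S\<^esub> D"
    if "A \<in> ?M" "B \<in> ?M" "C \<in> ?M" "D \<in> ?M" for A B C D
  proof (rule mat_eqI)
    fix i j
    assume ij: "i < n" "j < n"
    have "A $$ (i, k) \<boxdot> C $$ (k, j) = B $$ (i, k) \<boxdot> D $$ (k, j)" if "k \<le> n - 1" for k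
      using \<open>A \<in> ?M\<close> \<open>B \<in> ?M\<close> \<open>C \<in> ?M\<close> \<open>D \<in> ?M\<close> ij n that by (simp add: prod mat_carrier_iff)
    then have "l \<le> n - 1 \<Longrightarrow> srg_sum S (\<lambda>k. A $$ (i, k) \<boxdot> C $$ (k, j)) l
        = srg_sum S (\<lambda>k. B $$ (i, k) \<boxdot> D $$ (k, j)) l" for l
      by (induction l) auto
    then show "(A \<boxdot>\<^bsub>mat_srg n S\<^esub> C) $$ (i, j) = (B \<boxdot>\<^bsub>mat_srg n S\<^esub> D) $$ (i, j)"
      using ij by (simp add: mat_smul_index)
  qed (use that mat_smul_closed in auto)
  define r where "r = {(A, B). A \<in> ?M \<and> B \<in> ?M \<and> A $$ (0, 0) = B $$ (0, 0)}"
  have r: "srg_congruence (mat_srg n S) r"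
    unfolding srg_congruence_def
  proof (intro conjI allI impI)
    show "equiv ?M r"
      unfolding r_def by (intro equivI refl_onI symI transI) auto
    fix A B C D
    assume "(A, B) \<in> r" "(C, D) \<in> r"
    then show "(A \<boxplus>\<^bsub>mat_srg n S\<^esub> C, B \<boxplus>\<^bsub>mat_srg n S\<^esub> D) \<in> r"
      using n unfolding r_def by (auto simp: mat_sadd_closed mat_sadd_index)
    show "(A \<boxdot>\<^bsub>mat_srg n S\<^esub> C, B \<boxdot>\<^bsub>mat_srg n S\<^esub> D) \<in> r"
      using \<open>(A, B) \<in> r\<close> \<open>(C, D) \<in> r\<close> mat_prod[of A B C D]
      unfolding r_def by (auto simp: mat_smul_closed)
  qed
  have "congruence_simple S"
    using mat_simple_imp_simple[OF simple] n by simp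
  then obtain a b where ab: "a \<in> carrier S" "b \<in> carrier S" "a \<noteq> b"
    using simple_iff by blast
  let ?A = "mat n n (\<lambda>_. a)" and ?B = "mat n n (\<lambda>_. b)"
  \<comment> \<open>This differs from \<open>?A\<close> only in column 1, which exists because
    \<open>n \<ge> 2\<close>, and hence agrees with it at \<open>(0, 0)\<close>.\<close>
  let ?E = "mat n n (\<lambda>(i, j). if j = 1 then b else a)"
  have M: "?A \<in> ?M" "?B \<in> ?M" "?E \<in> ?M"
    using ab n by (auto simp: mat_carrier_iff)
  have "?A $$ (0, 1) \<noteq> ?E $$ (0, 1)"
    using ab n by simp
  then have "?A \<noteq> ?E"
    by metis
  moreover have "(?A, ?E) \<in> r"
    using M n by (simp add: r_def)
  ultimately have "(?A, ?B) \<in> r"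
    using mat_simpleD[OF simple r] M by blast
  then show False
    using ab n by (simp add: r_def)
qed

lemma srg_sum_absorbing:
  assumes w: "w \<in> carrier S" "\<And>a. a \<in> carrier S \<Longrightarrow> a \<boxplus> w = w"
    and "\<And>k. k \<le> m \<Longrightarrow> f k \<in> carrier S" "j \<le> m" "f j = w"
  shows "srg_sum S f m = w"
  using srg_sum_eqI[of m f j] assms by simp

text \<open>Matrices having \<open>w\<close> somewhere absorb both operations: a \<open>w\<close> in
  row \<open>i\<close> fills row \<open>i\<close> of a product on the right with \<open>w\<close>,
  and a \<open>w\<close> in column \<open>j\<close> fills column \<open>j\<close> of a product on
  the left. Collapsing this set is a congruence; for \<open>n \<ge> 2\<close> it has two members,
  and a constant matrix of another element lies outside.\<close>

lemma mat_simple_imp_no_bi_absorbing: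
  assumes simple: "congruence_simple (mat_srg n S)" and n: "n \<ge> 2"
  shows "\<not> (\<exists>w. bi_absorbing S w)"
proof
  let ?M = "carrier (mat_srg n S)"
  assume "\<exists>w. bi_absorbing S w"
  then obtain w where w: "w \<in> carrier S" "\<And>a. a \<in> carrier S \<Longrightarrow> a \<boxdot> w = w"
    "\<And>a. a \<in> carrier S \<Longrightarrow> w \<boxdot> a = w" "\<And>a. a \<in> carrier S \<Longrightarrow> a \<boxplus> w = w"
    unfolding bi_absorbing_def by blast
  have w': "w \<boxplus> a = w" if "a \<in> carrier S" for a
    using w that sadd_commute by metis
  define I where "I = {A \<in> ?M. \<exists>i<n. \<exists>j<n. A $$ (i, j) = w}"
  have I_I: "A \<in> I" if "A \<in> ?M" "i < n" "j < n" "A $$ (i, j) = w" for A i j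
    using that unfolding I_def by blast
  have I_sadd: "A \<boxplus>\<^bsub>mat_srg n S\<^esub> C \<in> I" "C \<boxplus>\<^bsub>mat_srg n S\<^esub> A \<in> I" if "A \<in> I" "C \<in> ?M" for A C
  proof -
    obtain i j where ij: "A \<in> ?M" "i < n" "j < n" "A $$ (i, j) = w"
      using \<open>A \<in> I\<close> unfolding I_def by blast
    then have "(A \<boxplus>\<^bsub>mat_srg n S\<^esub> C) $$ (i, j) = w" "(C \<boxplus>\<^bsub>mat_srg n S\<^esub> A) $$ (i, j) = w"
      using \<open>C \<in> ?M\<close> w w' by (auto simp: mat_sadd_index mat_carrier_iff)
    then show "A \<boxplus>\<^bsub>mat_srg n S\<^esub> C \<in> I" "C \<boxplus>\<^bsub>mat_srg n S\<^esub> A \<in> I"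
      using ij \<open>C \<in> ?M\<close> unfolding I_def by (auto simp: mat_sadd_closed)
  qed
  have I_smul: "A \<boxdot>\<^bsub>mat_srg n S\<^esub> C \<in> I" "C \<boxdot>\<^bsub>mat_srg n S\<^esub> A \<in> I" if "A \<in> I" "C \<in> ?M" for A C
  proof -
    obtain i j where ij: "A \<in> ?M" "i < n" "j < n" "A $$ (i, j) = w"
      using \<open>A \<in> I\<close> unfolding I_def by blast
    have "srg_sum S (\<lambda>k. A $$ (i, k) \<boxdot> C $$ (k, 0)) (n - 1) = w"
      using ij that w n by (intro srg_sum_absorbing[of _ _ _ j]) (auto simp: mat_carrier_iff smul_closed)
    then show "A \<boxdot>\<^bsub>mat_srg n S\<^esub> C \<in> I"
      using ij that n by (intro I_I[of _ i 0]) (auto simp: mat_smul_closed mat_smul_index)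
    have "srg_sum S (\<lambda>k. C $$ (0, k) \<boxdot> A $$ (k, j)) (n - 1) = w"
      using ij that w n by (intro srg_sum_absorbing[of _ _ _ i]) (auto simp: mat_carrier_iff smul_closed)
    then show "C \<boxdot>\<^bsub>mat_srg n S\<^esub> A \<in> I"
      using ij that n by (intro I_I[of _ 0 j]) (auto simp: mat_smul_closed mat_smul_index)
  qed
  have IM: "I \<subseteq> ?M"
    unfolding I_def by blast
  define r where "r = {(A, B). A \<in> ?M \<and> B \<in> ?M \<and> (A = B \<or> A \<in> I \<and> B \<in> I)}"
  have r: "srg_congruence (mat_srg n S) r"
    unfolding srg_congruence_def
  proof (intro conjI allI impI)
    show "equiv ?M r"
      unfolding r_def by (intro equivI refl_onI symI transI) auto
    fix A B C D
    assume "(A, B) \<in> r" "(C, D) \<in> r"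
    then show "(A \<boxplus>\<^bsub>mat_srg n S\<^esub> C, B \<boxplus>\<^bsub>mat_srg n S\<^esub> D) \<in> r"
      "(A \<boxdot>\<^bsub>mat_srg n S\<^esub> C, B \<boxdot>\<^bsub>mat_srg n S\<^esub> D) \<in> r"
      using I_sadd I_smul unfolding r_def by (auto simp: mat_sadd_closed mat_smul_closed)
  qed
  have "congruence_simple S"
    using mat_simple_imp_simple[OF simple] n by simp
  then obtain a where a: "a \<in> carrier S" "a \<noteq> w"
    using simple_iff by metis
  let ?A = "mat n n (\<lambda>_. a)" and ?W = "mat n n (\<lambda>_. w)"
  let ?E = "mat n n (\<lambda>(i, j). if j = 1 then a else w)"
  have M: "?A \<in> ?M" "?W \<in> ?M" "?E \<in> ?M"
    using a w n by (auto simp: mat_carrier_iff)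
  have I: "?W \<in> I" "?E \<in> I"
    using M n unfolding I_def by (auto intro!: exI[of _ 0])
  have "?W $$ (0, 1) \<noteq> ?E $$ (0, 1)"
    using a n by simp
  then have "?W \<noteq> ?E"
    by metis
  moreover have "(?W, ?E) \<in> r"
    using M I by (simp add: r_def)
  ultimately have "(?W, ?A) \<in> r"
    using mat_simpleD[OF simple r] M by blast
  moreover have "?A \<notin> I"
    using a unfolding I_def by auto
  moreover have "?W \<noteq> ?A"
    using a n const_mat_eq_iff[of n w a] by auto
  ultimately show False
    by (auto simp: r_def)
qed

section \<open>Transfer of simplicity from S to its matrices\<close>

lemma index_in_elements_mat:
  assumes "A \<in> carrier (mat_srg n S)" "i < n" "j < n"
  shows "A $$ (i, j) \<in> elements_mat A"
  using assms by (intro elements_matI[of A n n i j]) (simp_all add: mat_carrier_iff)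

lemma finite_upper_bound:
  assumes "finite F" "F \<subseteq> carrier S"
  shows "\<exists>h \<in> carrier S. \<forall>x \<in> F. x \<preceq> h"
  using assms
proof (induction F rule: finite_induct)
  case empty
  then show ?case
    using nonempty by blast
next
  case (insert x F)
  then obtain h where h: "h \<in> carrier S" "\<forall>y \<in> F. y \<preceq> h"
    by auto
  have "y \<preceq> x \<boxplus> h" if "y \<in> insert x F" for y
    using that insert.prems h ple_sadd1[of x h] ple_sadd2[of x h] ple_trans[of y h "x \<boxplus> h"] sadd_closed
    by auto
  then show ?case
    using h insert.prems sadd_closed by blast
qed

text \<open>Joins provide upper bounds, but meets need not exist, so lower bounds of pairs enter as
  a hypothesis.\<close>

lemma finite_lower_bound:
  assumes lower: "\<And>x y. \<lbrakk>x \<in> carrier S; y \<in> carrier S\<rbrakk> \<Longrightarrow> \<exists>l \<in> carrier S. l \<preceq> x \<and> l \<preceq> y"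
    and "finite F" "F \<subseteq> carrier S"
  shows "\<exists>h \<in> carrier S. \<forall>x \<in> F. h \<preceq> x"
  using assms(2,3)
proof (induction F rule: finite_induct)
  case empty
  then show ?case
    using nonempty by blast
next
  case (insert x F)
  then obtain h where h: "h \<in> carrier S" "\<forall>y \<in> F. h \<preceq> y"
    by auto
  obtain l where l: "l \<in> carrier S" "l \<preceq> x" "l \<preceq> h"
    using lower[of x h] h(1) insert.prems by auto
  have "l \<preceq> y" if "y \<in> F" for y
    using that l h insert.prems ple_trans[of l h y] by auto
  then show ?case
    using l by blast
qed

text \<open>Multiplying on both sides by matrices which are \<open>u\<close> on one column (row) and \<open>v\<close> elsewhere
  spreads a chosen entry over the whole matrix; constant matrices then reduce the question to \<open>S\<close>.\<close>

theorem mat_simple_of_dominating: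
  assumes simple: "congruence_simple S" and n: "n > 0"
    and lower: "\<And>x y. \<lbrakk>x \<in> carrier S; y \<in> carrier S\<rbrakk> \<Longrightarrow> \<exists>l \<in> carrier S. l \<preceq> x \<and> l \<preceq> y"
    and dominating: "\<And>F. \<lbrakk>finite F; F \<subseteq> carrier S\<rbrakk> \<Longrightarrow> \<exists>u \<in> carrier S. \<exists>v \<in> carrier S.
        inj_on ((\<boxdot>) u) (carrier S) \<and> (\<forall>x \<in> F. \<forall>y \<in> F. v \<boxdot> x \<preceq> u \<boxdot> y)"
  shows "congruence_simple (mat_srg n S)"
proof -
  let ?C = "carrier S" and ?M = "carrier (mat_srg n S)"
  let ?c = "\<lambda>c. mat n n (\<lambda>_. c)"
  have c_sadd: "?c x \<boxplus>\<^bsub>mat_srg n S\<^esub> ?c y = ?c (x \<boxplus> y)" for x y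
    by (auto simp: mat_srg_def)
  \<comment> \<open>The entry is a sum of \<open>n\<close> copies of \<open>x y\<close>, which
    idempotency reduces to one.\<close>
  have c_smul: "?c x \<boxdot>\<^bsub>mat_srg n S\<^esub> ?c y = ?c (x \<boxdot> y)" if "x \<in> ?C" "y \<in> ?C" for x y
  proof (rule mat_eqI)
    fix i j
    assume "i < n" "j < n"
    then show "(?c x \<boxdot>\<^bsub>mat_srg n S\<^esub> ?c y) $$ (i, j) = ?c (x \<boxdot> y) $$ (i, j)"
      using that srg_sum_eqI[of "n - 1" "\<lambda>k. ?c x $$ (i, k) \<boxdot> ?c y $$ (k, j)" 0]
      by (simp add: mat_smul_index idem smul_closed)
  qed (use that n in \<open>auto intro!: mat_smul_closed simp: const_mat_carrier_iff smul_closed\<close>)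
  have full: "(X, Y) \<in> r"
    if r: "srg_congruence (mat_srg n S) r" and AB: "(A, B) \<in> r" "A \<noteq> B"
      and XY: "X \<in> ?M" "Y \<in> ?M" for r A B X Y
  proof -
    have equiv: "equiv ?M r"
      and r_sadd: "\<And>A B C D. \<lbrakk>(A, B) \<in> r; (C, D) \<in> r\<rbrakk>
        \<Longrightarrow> (A \<boxplus>\<^bsub>mat_srg n S\<^esub> C, B \<boxplus>\<^bsub>mat_srg n S\<^esub> D) \<in> r"
      and r_smul: "\<And>A B C D. \<lbrakk>(A, B) \<in> r; (C, D) \<in> r\<rbrakk>
        \<Longrightarrow> (A \<boxdot>\<^bsub>mat_srg n S\<^esub> C, B \<boxdot>\<^bsub>mat_srg n S\<^esub> D) \<in> r"
      using r unfolding srg_congruence_def by blast+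
    then have r_sub: "r \<subseteq> ?M \<times> ?M" and r_refl: "\<And>A. A \<in> ?M \<Longrightarrow> (A, A) \<in> r"
      and r_sym: "\<And>A B. (A, B) \<in> r \<Longrightarrow> (B, A) \<in> r"
      and r_trans: "\<And>A B C. \<lbrakk>(A, B) \<in> r; (B, C) \<in> r\<rbrakk> \<Longrightarrow> (A, C) \<in> r"
      unfolding equiv_def refl_on_def sym_def trans_def by blast+
    have M: "A \<in> ?M" "B \<in> ?M"
      using AB r_sub by auto
    then obtain i j where ij: "i < n" "j < n" "A $$ (i, j) \<noteq> B $$ (i, j)"
      using mat_eqI AB(2) by blast
    let ?F = "elements_mat A \<union> elements_mat B"
    have F: "finite ?F" "?F \<subseteq> ?C"
      using M by (auto simp: mat_srg_def elements_mat_def)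
    obtain u v where uv: "u \<in> ?C" "v \<in> ?C" "inj_on ((\<boxdot>) u) ?C"
        "\<forall>x \<in> ?F. \<forall>y \<in> ?F. v \<boxdot> x \<preceq> u \<boxdot> y"
      using dominating[OF F] by (elim bexE conjE)
    let ?P = "mat n n (\<lambda>(k, l). if l = i then u else v)"
    let ?Q = "mat n n (\<lambda>(k, l). if k = j then u else v)"
    have PQ: "?P \<in> ?M" "?Q \<in> ?M"
      using uv by (auto simp: mat_carrier_iff)
    \<comment> \<open>In each sum the summand carrying \<open>u\<close> dominates. Multiplying by
      \<open>?Q\<close> makes row \<open>k\<close> constantly \<open>u D(k, j)\<close>; multiplying
      by \<open>?P\<close> then selects row \<open>i\<close>.\<close>
    have spread: "?P \<boxdot>\<^bsub>mat_srg n S\<^esub> (D \<boxdot>\<^bsub>mat_srg n S\<^esub> ?Q) = ?c (u \<boxdot> (u \<boxdot> D $$ (i, j)))"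
      if D: "D = A \<or> D = B" for D
    proof (rule mat_eqI)
      have DM: "D \<in> ?M" and D_closed: "\<And>k l. \<lbrakk>k < n; l < n\<rbrakk> \<Longrightarrow> D $$ (k, l) \<in> ?C"
        using D M by (auto simp: mat_carrier_iff)
      have D_le: "v \<boxdot> D $$ (k, l) \<preceq> u \<boxdot> D $$ (k', l')"
        if "k < n" "l < n" "k' < n" "l' < n" for k l k' l'
      proof -
        have "D $$ (k, l) \<in> ?F" "D $$ (k', l') \<in> ?F"
          using D that index_in_elements_mat[OF M(1)] index_in_elements_mat[OF M(2)]
          by (elim disjE; simp)+
        from bspec[OF bspec[OF uv(4) this(1)] this(2)] show ?thesis .
      qed
      have DQ: "(D \<boxdot>\<^bsub>mat_srg n S\<^esub> ?Q) $$ (k, l) = u \<boxdot> D $$ (k, j)" if kl: "k < n" "l < n" for k l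
      proof -
        have "srg_sum S (\<lambda>m. D $$ (k, m) \<boxdot> ?Q $$ (m, l)) (n - 1) = D $$ (k, j) \<boxdot> ?Q $$ (j, l)"
        proof (rule srg_sum_eqI)
          fix m
          assume "m \<le> n - 1"
          then have m: "m < n"
            using n by simp
          show "D $$ (k, m) \<boxdot> ?Q $$ (m, l) \<in> ?C"
            using m kl uv D_closed by (simp add: smul_closed)
          show "D $$ (k, m) \<boxdot> ?Q $$ (m, l) \<preceq> D $$ (k, j) \<boxdot> ?Q $$ (j, l)"
            using D_le[of k m k j] m kl ij uv D_closed
            by (cases "m = j") (simp_all add: idem smul_closed smul_commute[of _ v] smul_commute[of _ u])
        qed (use ij in simp)
        then show ?thesis
          using kl ij uv D_closed by (simp add: mat_smul_index smul_commute[of _ u])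
      qed
      fix k l
      assume kl: "k < n" "l < n"
      have "srg_sum S (\<lambda>m. ?P $$ (k, m) \<boxdot> (D \<boxdot>\<^bsub>mat_srg n S\<^esub> ?Q) $$ (m, l)) (n - 1)
          = ?P $$ (k, i) \<boxdot> (D \<boxdot>\<^bsub>mat_srg n S\<^esub> ?Q) $$ (i, l)"
      proof (rule srg_sum_eqI)
        fix m
        assume "m \<le> n - 1"
        then have m: "m < n"
          using n by simp
        show "?P $$ (k, m) \<boxdot> (D \<boxdot>\<^bsub>mat_srg n S\<^esub> ?Q) $$ (m, l) \<in> ?C"
          using m kl ij uv D_closed by (simp add: DQ smul_closed)
        have "u \<boxdot> (v \<boxdot> D $$ (m, j)) \<preceq> u \<boxdot> (u \<boxdot> D $$ (i, j))"
          using D_le[of m j i j] m ij uv D_closed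
          by (metis distrib_left smul_closed)
        then show "?P $$ (k, m) \<boxdot> (D \<boxdot>\<^bsub>mat_srg n S\<^esub> ?Q) $$ (m, l)
            \<preceq> ?P $$ (k, i) \<boxdot> (D \<boxdot>\<^bsub>mat_srg n S\<^esub> ?Q) $$ (i, l)"
          using m kl ij uv D_closed
          by (cases "m = i") (simp_all add: DQ idem smul_closed smul_lcomm[of v u])
      qed (use ij in simp)
      then show "(?P \<boxdot>\<^bsub>mat_srg n S\<^esub> (D \<boxdot>\<^bsub>mat_srg n S\<^esub> ?Q)) $$ (k, l)
          = ?c (u \<boxdot> (u \<boxdot> D $$ (i, j))) $$ (k, l)"
        using kl ij by (simp add: mat_smul_index[of k] DQ)
    next
      show "?P \<boxdot>\<^bsub>mat_srg n S\<^esub> (D \<boxdot>\<^bsub>mat_srg n S\<^esub> ?Q) \<in> ?M"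
        using PQ D M by (auto intro: mat_smul_closed)
      show "?c (u \<boxdot> (u \<boxdot> D $$ (i, j))) \<in> ?M"
        using D M uv ij n by (auto simp: const_mat_carrier_iff mat_carrier_iff smul_closed)
    qed
    define a b where "a = u \<boxdot> (u \<boxdot> A $$ (i, j))" and "b = u \<boxdot> (u \<boxdot> B $$ (i, j))"
    have ABij: "A $$ (i, j) \<in> ?C" "B $$ (i, j) \<in> ?C"
      using M ij by (auto simp: mat_carrier_iff)
    then have ab: "a \<in> ?C" "b \<in> ?C" "a \<noteq> b"
      using ij(3) uv smul_closed unfolding a_def b_def by (auto dest!: inj_onD[OF uv(3)])
    have "(?c a, ?c b) \<in> r"
      using r_smul[OF r_refl[OF PQ(1)] r_smul[OF AB(1) r_refl[OF PQ(2)]]] spread[of A] spread[of B]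
      by (simp add: a_def b_def)
    then have const: "(?c x, ?c y) \<in> r" if "x \<in> ?C" "y \<in> ?C" for x y
    proof -
      have "(\<forall>x \<in> ?C. \<forall>y \<in> ?C. (?c x, ?c y) \<in> r \<longrightarrow> x = y)
        \<or> (\<forall>x \<in> ?C. \<forall>y \<in> ?C. (?c x, ?c y) \<in> r)"
        using simple
      proof (rule simple_cases)
        fix x
        assume "x \<in> ?C"
        then show "(?c x, ?c x) \<in> r"
          using r_refl n by (simp add: const_mat_carrier_iff)
      next
        fix x y z
        assume "(?c x, ?c y) \<in> r" "x \<in> ?C" "y \<in> ?C" "z \<in> ?C"
        moreover from this have "(?c z, ?c z) \<in> r"
          using r_refl n by (simp add: const_mat_carrier_iff)
        ultimately show "(?c (x \<boxplus> z), ?c (y \<boxplus> z)) \<in> r" "(?c (x \<boxdot> z), ?c (y \<boxdot> z)) \<in> r"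
          using r_sadd r_smul c_sadd c_smul by metis+
      qed (rule r_sym r_trans; assumption)+
      with \<open>(?c a, ?c b) \<in> r\<close> ab that show ?thesis
        by blast
    qed
    let ?G = "elements_mat X \<union> elements_mat Y"
    have G: "finite ?G" "?G \<subseteq> ?C"
      using XY by (auto simp: mat_srg_def elements_mat_def)
    obtain h where h: "h \<in> ?C" "\<forall>x \<in> ?G. x \<preceq> h"
      using finite_upper_bound[OF G] by blast
    obtain l where l: "l \<in> ?C" "\<forall>x \<in> ?G. l \<preceq> x"
      using finite_lower_bound[OF lower G] by blast
    \<comment> \<open>Adding \<open>Z\<close> to the related pair of constant matrices for
      \<open>l\<close> and \<open>h\<close> leaves \<open>Z\<close> on one side and the constant
      matrix for \<open>h\<close> on the other.\<close>
    have top: "(Z, ?c h) \<in> r" if Z: "Z = X \<or> Z = Y" for Z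
    proof -
      have ZM: "Z \<in> ?M"
        using Z XY by blast
      have Z_le: "l \<preceq> Z $$ (p, q) \<and> Z $$ (p, q) \<preceq> h \<and> Z $$ (p, q) \<in> ?C" if "p < n" "q < n" for p q
      proof -
        have "Z $$ (p, q) \<in> ?G"
          using Z that index_in_elements_mat[OF XY(1)] index_in_elements_mat[OF XY(2)]
          by (elim disjE; simp)
        then show ?thesis
          using l h G by blast
      qed
      have "Z \<boxplus>\<^bsub>mat_srg n S\<^esub> ?c l = Z"
        using ZM l n Z_le sadd_commute[of _ l]
        by (intro mat_eqI[of _ n]) (auto simp: mat_sadd_index mat_sadd_closed const_mat_carrier_iff)
      moreover have "Z \<boxplus>\<^bsub>mat_srg n S\<^esub> ?c h = ?c h"
        using ZM h n Z_le
        by (intro mat_eqI[of _ n]) (auto simp: mat_sadd_index mat_sadd_closed const_mat_carrier_iff)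
      ultimately show ?thesis
        using r_sadd[OF r_refl[OF ZM] const[OF l(1) h(1)]] by simp
    qed
    show ?thesis
      using top[of X] top[of Y] r_sym r_trans by blast
  qed
  obtain a b where ab: "a \<in> ?C" "b \<in> ?C" "a \<noteq> b"
    using simple simple_iff by blast
  have "r = Id_on ?M \<or> r = ?M \<times> ?M" if r: "srg_congruence (mat_srg n S) r" for r
  proof (cases "\<exists>A B. (A, B) \<in> r \<and> A \<noteq> B")
    case True
    then have "?M \<times> ?M \<subseteq> r"
      using full[OF r] by auto
    then show ?thesis
      using r by (auto simp: srg_congruence_def equiv_def)
  next
    case False
    then show ?thesis
      using r by (auto simp: srg_congruence_def equiv_def refl_on_def)
  qed
  moreover have "?c a \<in> ?M" "?c b \<in> ?M" "?c a \<noteq> ?c b"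
    using ab n by (auto simp: const_mat_carrier_iff const_mat_eq_iff)
  ultimately show ?thesis
    using mat_simple_iff by blast
qed

text \<open>The unit \<open>e\<close> and the zero \<open>z\<close> serve as \<open>u\<close> and
  \<open>v\<close>: multiplication by \<open>e\<close> is the identity, and every product with
  \<open>z\<close> is the least element.\<close>

lemma mat_simple_of_L2:
  assumes n: "n > 0" and iso: "srg_isomorphic S L2"
  shows "congruence_simple (mat_srg n S)"
proof -
  obtain h where h: "bij_betw h (carrier S) UNIV"
    "\<And>a b. \<lbrakk>a \<in> carrier S; b \<in> carrier S\<rbrakk> \<Longrightarrow> h (a \<boxplus> b) = (h a \<or> h b)"
    "\<And>a b. \<lbrakk>a \<in> carrier S; b \<in> carrier S\<rbrakk> \<Longrightarrow> h (a \<boxdot> b) = (h a \<and> h b)"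
    using iso unfolding srg_isomorphic_def L2_def by auto
  have h_eq: "a = b \<longleftrightarrow> h a = h b" if "a \<in> carrier S" "b \<in> carrier S" for a b
    using h(1) that by (auto simp: bij_betw_def dest: inj_onD)
  obtain z e where ze: "z \<in> carrier S" "\<not> h z" "e \<in> carrier S" "h e"
    using h(1) unfolding bij_betw_def by (metis (full_types) UNIV_I imageE)
  have C: "x = z \<or> x = e" if "x \<in> carrier S" for x
    using h_eq that ze by metis
  have "congruence_simple S"
    unfolding simple_iff
  proof (intro conjI allI impI)
    show "\<exists>a \<in> carrier S. \<exists>b \<in> carrier S. a \<noteq> b"
      using ze by (intro bexI[of _ z] bexI[of _ e]) auto
    fix r
    assume "srg_congruence S r"
    then have equiv: "r \<subseteq> carrier S \<times> carrier S" "refl_on (carrier S) r" "sym r"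
      by (auto simp: srg_congruence_def equiv_def)
    show "r = Id_on (carrier S) \<or> r = carrier S \<times> carrier S"
    proof (cases "(z, e) \<in> r")
      case True
      then have "(x, y) \<in> r" if "x \<in> carrier S" "y \<in> carrier S" for x y
        using C that equiv(2) symD[OF equiv(3)] by (metis refl_onD)
      then show ?thesis
        using equiv(1) by auto
    next
      case False
      then have "x = y" if "(x, y) \<in> r" for x y
        using that C equiv(1) symD[OF equiv(3)] by blast
      then show ?thesis
        using equiv(1,2) by (auto simp: refl_on_def)
    qed
  qed
  then show ?thesis
    using n
  proof (rule mat_simple_of_dominating)
    fix x y
    assume "x \<in> carrier S" "y \<in> carrier S"
    then show "\<exists>l \<in> carrier S. l \<preceq> x \<and> l \<preceq> y"
      using ze h_eq h(2) sadd_closed by (intro bexI[of _ z]) auto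
  next
    fix F
    assume "F \<subseteq> carrier S"
    then show "\<exists>u \<in> carrier S. \<exists>v \<in> carrier S.
        inj_on ((\<boxdot>) u) (carrier S) \<and> (\<forall>x \<in> F. \<forall>y \<in> F. v \<boxdot> x \<preceq> u \<boxdot> y)"
      using ze h_eq h(2,3) sadd_closed smul_closed
      by (intro bexI[of _ e] bexI[of _ z]) (auto intro!: inj_onI simp: subset_iff)
  qed
qed

end

section \<open>Simplicity of max-plus semirings with values of both signs\<close>

context max_plus_srg
begin

lemma ex_multiple:
  assumes "a \<in> carrier S" "k > 0"
  shows "\<exists>c \<in> carrier S. \<phi> c = real k * \<phi> a"
proof -
  have "\<exists>c \<in> carrier S. \<phi> c = real (Suc m) * \<phi> a" for m
  proof (induction m)
    case (Suc m)
    then obtain c where "c \<in> carrier S" "\<phi> c = real (Suc m) * \<phi> a"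
      by blast
    then show ?case
      using assms(1) by (intro bexI[of _ "c \<boxdot> a"]) (auto simp: \<phi>_smul smul_closed algebra_simps)
  qed (use assms(1) in auto)
  then show ?thesis
    using assms(2) by (metis Suc_pred)
qed

context
  fixes a b
  assumes a: "a \<in> carrier S" "\<phi> a > 0" and b: "b \<in> carrier S" "\<phi> b < 0"
begin

text \<open>An interval to the right of 0 contains a positive multiple of \<open>\<phi> a\<close>,
  one to the left a positive multiple of \<open>\<phi> b\<close>. If it contains 0, its length
  forces it to contain \<open>\<phi> a\<close> or \<open>\<phi> b\<close>; 0 itself need not be a
  value.\<close>

lemma ex_\<phi>_in_interval:
  assumes "hi - lo \<ge> \<phi> a - \<phi> b"
  shows "\<exists>c \<in> carrier S. lo \<le> \<phi> c \<and> \<phi> c \<le> hi"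
proof -
  consider "lo > 0" | "hi < 0" | "lo \<le> \<phi> a" "\<phi> a \<le> hi" | "lo \<le> \<phi> b" "\<phi> b \<le> hi"
    using assms a b by linarith
  then show ?thesis
  proof cases
    case 1
    define k where "k = nat \<lceil>lo / \<phi> a\<rceil>"
    have "lo / \<phi> a > 0"
      using 1 a by simp
    then have k: "k > 0" "lo / \<phi> a \<le> real k" "real k < lo / \<phi> a + 1"
      unfolding k_def by linarith+
    obtain c where "c \<in> carrier S" "\<phi> c = real k * \<phi> a"
      using ex_multiple[OF a(1) k(1)] by blast
    moreover have "lo \<le> real k * \<phi> a" "real k * \<phi> a < lo + \<phi> a"
      using k a by (auto simp: field_simps)
    ultimately show ?thesis
      using assms b by (intro bexI[of _ c]) auto
  next
    case 2
    define k where "k = nat \<lceil>hi / \<phi> b\<rceil>"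
    have "hi / \<phi> b > 0"
      using 2 b by (simp add: divide_neg_neg)
    then have k: "k > 0" "hi / \<phi> b \<le> real k" "real k < hi / \<phi> b + 1"
      unfolding k_def by linarith+
    obtain c where "c \<in> carrier S" "\<phi> c = real k * \<phi> b"
      using ex_multiple[OF b(1) k(1)] by blast
    moreover have "real k * \<phi> b \<le> hi" "hi + \<phi> b < real k * \<phi> b"
      using k b by (auto simp: field_simps)
    ultimately show ?thesis
      using assms a by (intro bexI[of _ c]) auto
  qed (use a b in auto)
qed

text \<open>Powers of a related pair widen its gap without bound, and a factor \<open>c\<close>
  translates the widened pair around any prescribed \<open>x\<close> and \<open>y\<close>.
  Everything between related \<open>p\<close> and \<open>q\<close> is related to \<open>q\<close>,
  as adding \<open>z\<close> to both gives \<open>z\<close> and \<open>q\<close>.\<close>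

lemma max_plus_simple: "congruence_simple S"
  unfolding simple_iff
proof (intro conjI allI impI)
  show "\<exists>x \<in> carrier S. \<exists>y \<in> carrier S. x \<noteq> y"
    using a b by (metis less_asym)
  fix r
  assume r: "srg_congruence S r"
  then have r_sub: "r \<subseteq> carrier S \<times> carrier S"
    and r_refl: "\<And>x. x \<in> carrier S \<Longrightarrow> (x, x) \<in> r"
    and r_sym: "\<And>x y. (x, y) \<in> r \<Longrightarrow> (y, x) \<in> r"
    and r_trans: "\<And>x y z. \<lbrakk>(x, y) \<in> r; (y, z) \<in> r\<rbrakk> \<Longrightarrow> (x, z) \<in> r"
    and r_sadd: "\<And>x y z w. \<lbrakk>(x, y) \<in> r; (z, w) \<in> r\<rbrakk> \<Longrightarrow> (x \<boxplus> z, y \<boxplus> w) \<in> r"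
    and r_smul: "\<And>x y z w. \<lbrakk>(x, y) \<in> r; (z, w) \<in> r\<rbrakk> \<Longrightarrow> (x \<boxdot> z, y \<boxdot> w) \<in> r"
    unfolding srg_congruence_def equiv_def refl_on_def sym_def trans_def by blast+
  show "r = Id_on (carrier S) \<or> r = carrier S \<times> carrier S"
  proof (cases "\<exists>s t. (s, t) \<in> r \<and> s \<noteq> t")
    case False
    then show ?thesis
      using r_sub r_refl by auto
  next
    case True
    then obtain s t where st: "(s, t) \<in> r" "\<phi> s < \<phi> t"
      using r_sub r_sym \<phi>_eq_iff by (metis linorder_less_linear mem_Sigma_iff subsetD)
    have le: "(x, y) \<in> r" if xy: "x \<in> carrier S" "y \<in> carrier S" "\<phi> x \<le> \<phi> y" for x y
    proof -
      \<comment> \<open>The extra \<open>\<phi> a - \<phi> b\<close> is the length that guarantees a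
        value in the interval from which \<open>c\<close> is taken.\<close>
      obtain m :: nat where m: "\<phi> y - \<phi> x + \<phi> a - \<phi> b < real m * (\<phi> t - \<phi> s)"
        using reals_Archimedean3[of "\<phi> t - \<phi> s"] st(2) by auto
      have powers: "\<exists>s' t'. (s', t') \<in> r \<and> \<phi> s' = real (Suc k) * \<phi> s \<and> \<phi> t' = real (Suc k) * \<phi> t" for k
      proof (induction k)
        case 0
        then show ?case
          using st by (intro exI[of _ s] exI[of _ t]) simp
      next
        case (Suc k)
        then obtain s' t' where *: "(s', t') \<in> r" "\<phi> s' = real (Suc k) * \<phi> s" "\<phi> t' = real (Suc k) * \<phi> t"
          by blast
        then have "s' \<in> carrier S" "t' \<in> carrier S" "s \<in> carrier S" "t \<in> carrier S"
          using st r_sub by auto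
        then show ?case
          using r_smul[OF *(1) st(1)] *
          by (intro exI[of _ "s' \<boxdot> s"] exI[of _ "t' \<boxdot> t"]) (simp add: \<phi>_smul algebra_simps)
      qed
      have "m > 0"
        using m xy a b by (cases "m = 0") auto
      then obtain s' t' where s't': "(s', t') \<in> r" "\<phi> s' = real m * \<phi> s" "\<phi> t' = real m * \<phi> t"
        using powers[of "m - 1"] by auto
      then have C: "s' \<in> carrier S" "t' \<in> carrier S"
        using r_sub by auto
      obtain c where c: "c \<in> carrier S" "\<phi> y - \<phi> t' \<le> \<phi> c" "\<phi> c \<le> \<phi> x - \<phi> s'"
        using ex_\<phi>_in_interval[where hi = "\<phi> x - \<phi> s'" and lo = "\<phi> y - \<phi> t'"] m s't'
        by (auto simp: algebra_simps)
      define p q where "p = s' \<boxdot> c" and "q = t' \<boxdot> c"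
      have pq: "(p, q) \<in> r" "p \<in> carrier S" "q \<in> carrier S" "\<phi> p \<le> \<phi> x" "\<phi> y \<le> \<phi> q"
        using r_smul[OF s't'(1) r_refl[OF c(1)]] C c by (auto simp: p_def q_def \<phi>_smul smul_closed)
      have "(z, q) \<in> r" if "z \<in> carrier S" "\<phi> p \<le> \<phi> z" "\<phi> z \<le> \<phi> q" for z
      proof -
        have "p \<boxplus> z = z" "q \<boxplus> z = q"
          using that pq ple_iff[of p z] ple_iff[of z q] sadd_commute[of q z] by auto
        then show ?thesis
          using r_sadd[OF pq(1) r_refl[OF that(1)]] by simp
      qed
      then show ?thesis
        using xy pq r_sym r_trans by (meson order_trans)
    qed
    have "(x, y) \<in> r" if "x \<in> carrier S" "y \<in> carrier S" for x y
      using le[of x y] le[of y x] that r_sym linear by blast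
    then show ?thesis
      using r_sub by auto
  qed
qed

text \<open>If \<open>B\<close> bounds the absolute values on \<open>F\<close>, choosing
  \<open>\<phi> u \<ge> B\<close> and \<open>\<phi> v \<le> - B\<close> separates the products by 0:
  those with \<open>v\<close> have value at most 0, those with \<open>u\<close> at least 0.\<close>

lemma mat_max_plus_simple:
  assumes n: "n > 0"
  shows "congruence_simple (mat_srg n S)"
  using max_plus_simple n
proof (rule mat_simple_of_dominating)
  fix x y
  assume xy: "x \<in> carrier S" "y \<in> carrier S"
  then have "\<phi> x \<le> \<phi> y \<or> \<phi> y \<le> \<phi> x"
    by linarith
  then show "\<exists>l \<in> carrier S. l \<preceq> x \<and> l \<preceq> y"
    using xy idem ple_iff by blast
next
  fix F
  assume F: "finite F" "F \<subseteq> carrier S"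
  obtain B where B: "\<forall>x \<in> F. \<bar>\<phi> x\<bar> \<le> B"
    using F(1) by (metis finite_imageI Max_ge imageI)
  obtain u where u: "u \<in> carrier S" "B \<le> \<phi> u"
    using ex_\<phi>_in_interval[of "B + (\<phi> a - \<phi> b)" B] by auto
  obtain v where v: "v \<in> carrier S" "\<phi> v \<le> - B"
    using ex_\<phi>_in_interval[of "- B" "- B - (\<phi> a - \<phi> b)"] by auto
  have "inj_on ((\<boxdot>) u) (carrier S)"
    using u \<phi>_eq_iff \<phi>_smul by (intro inj_onI) (metis add_left_cancel)
  moreover have "v \<boxdot> x \<preceq> u \<boxdot> y" if "x \<in> F" "y \<in> F" for x y
  proof -
    have "x \<in> carrier S" "y \<in> carrier S"
      using F that by auto
    moreover have "\<bar>\<phi> x\<bar> \<le> B" "\<bar>\<phi> y\<bar> \<le> B"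
      using B that by auto
    ultimately show ?thesis
      using u v by (simp add: ple_iff \<phi>_smul smul_closed)
  qed
  ultimately show "\<exists>u \<in> carrier S. \<exists>v \<in> carrier S.
      inj_on ((\<boxdot>) u) (carrier S) \<and> (\<forall>x \<in> F. \<forall>y \<in> F. v \<boxdot> x \<preceq> u \<boxdot> y)"
    using u v by (intro bexI[of _ u] bexI[of _ v] conjI ballI)
qed

end

end

lemma (in idem_comm_srg) mat_simple_of_max_plus:
  assumes n: "n > 0" and A: "A \<inter> {0<..} \<noteq> {}" "A \<inter> {..<0} \<noteq> {}"
    and iso: "srg_isomorphic S (R_max_plus\<lparr>carrier := A\<rparr>)"
  shows "congruence_simple (mat_srg n S)"
proof -
  obtain h where h: "bij_betw h (carrier S) A"
    "\<forall>a \<in> carrier S. \<forall>b \<in> carrier S. h (a \<boxplus> b) = max (h a) (h b) \<and> h (a \<boxdot> b) = h a + h b"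
    using iso unfolding srg_isomorphic_def by (simp add: R_max_plus_def) blast
  interpret max_plus_srg S h
    using h by unfold_locales (simp_all add: bij_betw_def)
  have "h ` carrier S = A"
    using h(1) by (simp add: bij_betw_def)
  then obtain a b where ab: "a \<in> carrier S" "h a > 0" "b \<in> carrier S" "h b < 0"
    using A by auto
  show ?thesis
    using ab n by (rule mat_max_plus_simple)
qed


theorem theorem3p2:
  fixes S :: "('a, 'm) srg_scheme" and n :: nat
  assumes "comm_srg S"
    and "add_idempotent S"
    and "n \<ge> 2"
  shows "(congruence_simple (mat_srg n S)
            \<longleftrightarrow> congruence_simple S \<and> card (product_set S) \<noteq> 1 \<and> \<not> (\<exists>w. bi_absorbing S w))
       \<and> (congruence_simple S \<and> card (product_set S) \<noteq> 1 \<and> \<not> (\<exists>w. bi_absorbing S w)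
            \<longleftrightarrow> srg_isomorphic S L2 \<or>
               (\<exists>A. subsemiring A R_max_plus \<and> A \<inter> {0<..} \<noteq> {} \<and> A \<inter> {..<0} \<noteq> {} \<and>
                    srg_isomorphic S (R_max_plus\<lparr>carrier := A\<rparr>)))"
    (is "(?i \<longleftrightarrow> ?ii) \<and> (?ii \<longleftrightarrow> ?iii)")
proof -
  interpret comm_srg S
    by fact
  interpret idem_comm_srg S
    by unfold_locales (use assms(2) in \<open>simp add: add_idempotent_def\<close>)
  have n: "n > 0"
    using assms(3) by simp
  have 1: ?ii if i: ?i
    by (intro conjI mat_simple_imp_simple[OF i n] mat_simple_imp_product_set[OF i assms(3)]
        mat_simple_imp_no_bi_absorbing[OF i assms(3)])
  have 2: ?iii if ii: ?ii
    by (rule simple_imp_isomorphic) (use ii in simp_all)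
  have 3: ?i if iii: ?iii
    using iii
  proof
    assume "srg_isomorphic S L2"
    with n show ?i
      by (rule mat_simple_of_L2)
  next
    assume "\<exists>A. subsemiring A R_max_plus \<and> A \<inter> {0<..} \<noteq> {} \<and> A \<inter> {..<0} \<noteq> {} \<and>
      srg_isomorphic S (R_max_plus\<lparr>carrier := A\<rparr>)"
    then show ?i
      by (elim exE conjE) (rule mat_simple_of_max_plus[OF n])
  qed
  from 1 2 3 show ?thesis
    by argo
qed

end
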